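(* Let $-3/2<c<-1/2$ and let $\tau\in\mathbb{C}$ (not necessarily real) with $|\operatorname{Im}(\tau)|<1/2$. Then $$\Xi(\tau)=\frac{1}{\pi i}\int_{-\infty+ic}^{\infty+ic}\frac{t\,\Xi(t)}{t^2-\tau^2}\,dt .$$
   Context: Riemann's function is $\xi(s)=(s-1)\pi^{-s/2}\Gamma(1+s/2)\zeta(s)$, where $\zeta$ is the Riemann zeta function; it extends to an entire function satisfying $\xi(1-s)=\xi(s)$. For $\tau\in\mathbb{C}$, $\Xi(\tau)=\xi(1/2+i\tau)$. The integral is taken along the horizontal line $\operatorname{Im}(t)=c$, from left to right. *)

theory Defs
  imports "HOL-Complex_Analysis.Complex_Analysis"
begin

(* The Riemann zeta function is the analytic continuation of its Dirichlet series to the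
   plane without 1.  The value 0 at the pole is only a convention that makes the function
   unique. *)
definition riemann_zeta :: "complex \<Rightarrow> complex" where
  "riemann_zeta = (THE f. f holomorphic_on (- {1}) \<and>
      (\<forall>s. Re s > 1 \<longrightarrow> f s = (\<Sum>n. 1 / of_nat (Suc n) powr s)) \<and> f 1 = 0)"

lemma riemann_zeta_eqI:
  assumes "f holomorphic_on (- {1})"
    and "\<And>s. Re s > 1 \<Longrightarrow> f s = (\<Sum>n. 1 / of_nat (Suc n) powr s)"
    and "f 1 = 0"
  shows "riemann_zeta = f"
  unfolding riemann_zeta_def
proof (rule the_equality)
  show "f holomorphic_on (- {1}) \<and>
      (\<forall>s. Re s > 1 \<longrightarrow> f s = (\<Sum>n. 1 / of_nat (Suc n) powr s)) \<and> f 1 = 0"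
    using assms by blast
next
  fix g :: "complex \<Rightarrow> complex"
  assume g: "g holomorphic_on (- {1}) \<and>
      (\<forall>s. Re s > 1 \<longrightarrow> g s = (\<Sum>n. 1 / of_nat (Suc n) powr s)) \<and> g 1 = 0"
  show "g = f"
  proof
    fix z
    show "g z = f z"
    proof (cases "z = 1")
      case True
      then show ?thesis using g assms by simp
    next
      case False
      show ?thesis
      proof (rule analytic_continuation_open[of "{s. Re s > 1}" "- {1}" g f z])
        show "open {s. Re s > 1}" by (rule open_halfspace_Re_gt)
        have "(2::complex) \<in> {s. Re s > 1}" by simp
        then show "{s. Re s > 1} \<noteq> {}" by blast
        show "connected (- {1 :: complex})"
          by (rule connected_punctured_universe) simp
      qed (use g assms False in \<open>auto simp: open_Compl\<close>)
    qed
  qed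
qed

(* The defining product is not literally defined at s = 1 and at s = -2, -4, ...; these
   singularities are removable, and xi takes the limit value there, so that it is the
   entire extension of the product. *)
definition riemann_xi :: "complex \<Rightarrow> complex" where
  "riemann_xi = remove_sings
     (\<lambda>s. (s - 1) * of_real pi powr (- s / 2) * Gamma (1 + s / 2) * riemann_zeta s)"

definition riemann_Xi :: "complex \<Rightarrow> complex" where
  "riemann_Xi \<tau> = riemann_xi (1 / 2 + \<i> * \<tau>)"

(* Integration along Im t = c from left to right, parametrised by t = x + i c, dt = dx. *)
definition hline_integrable :: "real \<Rightarrow> (complex \<Rightarrow> complex) \<Rightarrow> bool" where
  "hline_integrable c f \<longleftrightarrow> integrable lborel (\<lambda>x. f (Complex x c))"

definition hline_integral :: "real \<Rightarrow> (complex \<Rightarrow> complex) \<Rightarrow> complex" where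
  "hline_integral c f = (LINT x|lborel. f (Complex x c))"

end

theory Submission
  imports Defs "HOL-Probability.Characteristic_Functions" "HOL-Probability.Sinc_Integral"
    "HOL-Real_Asymp.Real_Asymp"
begin

text \<open>The function \<open>\<Xi>\<close> is entire and even by the functional equation, so \<open>t \<Xi>(t) / (t\<^sup>2 - \<tau>\<^sup>2)\<close> is odd, and
  integrating it over the boundary of the strip \<open>\<bar>Im t\<bar> \<le> - c\<close> gives twice the integral along
  \<open>Im t = c\<close>; by Cauchy's formula the result is \<open>2 \<pi> i \<Xi>(\<tau>)\<close>.

  The continuation of \<open>\<zeta>\<close> and the functional equation follow from Riemann's representation
  \<open>\<xi>(s) = 1/2 + s (s - 1) / 2 * (L(s/2) + L((1 - s)/2))\<close>, where \<open>L\<close> is the Laplace transform over \<open>u > 0\<close>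
  of \<open>\<Sum>n\<ge>1. exp (- \<pi> n\<^sup>2 e\<^sup>u)\<close>. The theta inversion behind it is Poisson summation for a Gaussian:
  one integrates the Gaussian against the 1-periodic trigonometric polynomial \<open>cos (\<pi> y) ^ (2 N)\<close>,
  normalised to have mean 1 over a period, and lets \<open>N\<close> tend to infinity. On the line \<open>Im t = c\<close> the zeta
  function is given by its Dirichlet series, and three uses of \<open>\<Gamma>(z + 1) = z \<Gamma>(z)\<close> give enough decay
  for integrability.\<close>

section \<open>Contour shift for even functions\<close>

lemma contour_integral_linepath_same_Im:
  assumes "a < b"
  shows "contour_integral (linepath (Complex a y) (Complex b y)) f =
    integral {a..b} (\<lambda>x. f (Complex x y))"
proof -
  let ?l = "linepath (Complex a y) (Complex b y)"
  have "contour_integral ?l f = of_real (b - a) * integral {0..1} (\<lambda>x. f (?l x))"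
    by (simp add: contour_integral_integral Complex_eq)
  also have "integral {0..1} (\<lambda>x. f (?l x)) =
             integral {0..(b - a) / (b - a)} (\<lambda>x. f (Complex (a + (b - a) * x) y))"
    using assms by (simp add: linepath_def Complex_eq scaleR_conv_of_real algebra_simps)
  also have "{0..(b - a) / (b - a)} = (\<lambda>x. x / (b - a)) ` {0..b - a}"
    using assms by simp
  also have "integral \<dots> (\<lambda>x. f (Complex (a + (b - a) * x) y)) =
             integral {a-a..b-a} (\<lambda>x. f (Complex (x + a) y)) / of_real (b - a)"
    using assms by (subst integral_stretch_real) (auto simp: scaleR_conv_of_real add_ac)
  also have "\<dots> = integral {a..b} (\<lambda>x. f (Complex x y)) / of_real (b - a)"
    by (subst integral_shift_real_ivl) (rule refl)
  finally show ?thesis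
    using assms by simp
qed

text \<open>Dominated convergence with the majorant \<open>norm F\<close>. It serves twice: for the
  horizontal side of the growing rectangle, and for the Gaussian integral that is cut into unit
  cells.\<close>

lemma integral_symmetric_interval_tendsto:
  fixes F :: "real \<Rightarrow> 'a::euclidean_space"
  assumes F: "integrable lborel F"
  shows "((\<lambda>R. integral {-R..R} F) \<longlongrightarrow> (LINT x|lborel. F x)) at_top"
proof -
  have eq: "integral {-R..R} F = (LINT x|lborel. indicator {-R..R} x *\<^sub>R F x)" for R
  proof -
    have "set_integrable lborel {-R..R} F"
      unfolding set_integrable_def using F by (intro integrable_mult_indicator) auto
    from set_borel_integral_eq_integral(2)[OF this] show ?thesis
      by (simp add: set_lebesgue_integral_def)
  qed
  have [measurable]: "F \<in> borel_measurable borel"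
    using F by (simp add: borel_measurable_integrable flip: measurable_lborel1)
  show ?thesis
    unfolding eq
  proof (rule integral_dominated_convergence_at_top[where w = "\<lambda>x. norm (F x)"])
    show "AE x in lborel. ((\<lambda>R. indicator {-R..R} x *\<^sub>R F x) \<longlongrightarrow> F x) at_top"
    proof (rule AE_I2, rule tendsto_eventually)
      fix x :: real
      show "\<forall>\<^sub>F R in at_top. indicator {-R..R} x *\<^sub>R F x = F x"
        using eventually_ge_at_top[of "\<bar>x\<bar>"] by eventually_elim (auto simp: indicator_def)
    qed
    show "\<forall>\<^sub>F R in at_top. AE x in lborel. norm (indicator {-R..R} x *\<^sub>R F x) \<le> norm (F x)"
      by (intro always_eventually) (auto simp: indicator_def)
  qed (use F in auto)
qed

text \<open>Separates the two simple poles, so that Cauchy's formula applies to each. For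
  \<open>\<tau> = 0\<close> both summands coincide and the identity persists, which spares a case
  distinction.\<close>

lemma symmetric_kernel_partial_fractions:
  fixes w \<tau> g :: complex
  assumes "w \<noteq> \<tau>" "w \<noteq> - \<tau>"
  shows "w * g / (w\<^sup>2 - \<tau>\<^sup>2) = (g / (w - \<tau>) + g / (w - (- \<tau>))) / 2"
proof -
  have "w - \<tau> \<noteq> 0" "w + \<tau> \<noteq> 0" using assms by (auto simp: add_eq_0_iff2)
  moreover have "w\<^sup>2 - \<tau>\<^sup>2 = (w - \<tau>) * (w + \<tau>)" by (simp add: power2_eq_square algebra_simps)
  ultimately show ?thesis by (simp add: divide_simps) (simp add: algebra_simps)
qed

text \<open>After partial fractions the kernel is the mean of \<open>1 / (t - \<tau>)\<close> and
  \<open>1 / (t + \<tau>)\<close>, each at most \<open>1 / d\<close> in norm.\<close>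

lemma norm_symmetric_kernel_le:
  fixes t \<tau> :: complex
  assumes d: "d > 0" "d \<le> norm (t - \<tau>)" "d \<le> norm (t - (- \<tau>))"
  shows "norm (t / (t\<^sup>2 - \<tau>\<^sup>2)) \<le> 1 / d" and "t\<^sup>2 - \<tau>\<^sup>2 \<noteq> 0"
proof -
  have ne: "t \<noteq> \<tau>" "t \<noteq> - \<tau>" using d by auto
  then show "t\<^sup>2 - \<tau>\<^sup>2 \<noteq> 0" by (auto simp: power2_eq_iff)
  have "norm (1 / (t - z)) \<le> 1 / d" if "d \<le> norm (t - z)" for z
    unfolding norm_divide using that d by (intro frac_le) auto
  from norm_triangle_mono[OF this[OF d(2)] this[OF d(3)]]
  have "norm (1 / (t - \<tau>) + 1 / (t - (- \<tau>))) / 2 \<le> 1 / d" by simp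
  then show "norm (t / (t\<^sup>2 - \<tau>\<^sup>2)) \<le> 1 / d"
    using symmetric_kernel_partial_fractions[OF ne, of 1] by (simp only: mult_1_right norm_divide norm_numeral)
qed

text \<open>The rectangle is centred at 0 and the integrand is odd, so opposite sides contribute
  equally: bottom and right side make up half of the boundary integral. By partial fractions and
  evenness of \<open>G\<close>, Cauchy's formula gives \<open>2 * pi * \<i> * G \<tau>\<close> for
  the whole boundary.\<close>

lemma even_cauchy_kernel_rectangle:
  fixes G :: "complex \<Rightarrow> complex" and b R :: real and \<tau> :: complex
  assumes G: "G holomorphic_on UNIV" and even: "\<And>t. G (- t) = G t"
    and \<tau>: "\<bar>Im \<tau>\<bar> < b" and R: "\<bar>Re \<tau>\<bar> < R"
  defines "f \<equiv> (\<lambda>t. t * G t / (t\<^sup>2 - \<tau>\<^sup>2))"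
  shows "integral {-R..R} (\<lambda>x. f (Complex x (- b))) +
      contour_integral (linepath (Complex R (- b)) (Complex R b)) f = of_real pi * \<i> * G \<tau>"
    and "f contour_integrable_on linepath (Complex R (- b)) (Complex R b)"
proof -
  define P where "P = rectpath (Complex (- R) (- b)) (Complex R b)"
  have pos: "R > 0" "b > 0" using \<tau> R by linarith+
  have box: "\<tau> \<in> box (Complex (- R) (- b)) (Complex R b)"
    "- \<tau> \<in> box (Complex (- R) (- b)) (Complex R b)"
    using \<tau> R by (auto simp: in_box_complex_iff)
  have notin: "\<tau> \<notin> path_image P" "- \<tau> \<notin> path_image P"
    using box pos unfolding P_def by (subst path_image_rectpath_cbox_minus_box; simp)+
  have split: "f w = (G w / (w - \<tau>) + G w / (w - (- \<tau>))) / 2" if "w \<noteq> \<tau>" "w \<noteq> - \<tau>" for w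
    unfolding f_def using that by (rule symmetric_kernel_partial_fractions)
  have cauchy: "((\<lambda>w. G w / (w - z)) has_contour_integral 2 * pi * \<i> * G z) P"
    if "z \<in> {\<tau>, - \<tau>}" for z
  proof -
    have "winding_number P z = 1"
      unfolding P_def using box that by (intro winding_number_rectpath) auto
    moreover have "((\<lambda>w. G w / (w - z)) has_contour_integral
        (2 * pi * \<i> * winding_number P z * G z)) P"
      using notin that
      by (intro Cauchy_integral_formula_convex_simple[of UNIV] G) (auto simp: P_def)
    ultimately show ?thesis by simp
  qed
  have "((\<lambda>w. (G w / (w - \<tau>) + G w / (w - (- \<tau>))) / 2) has_contour_integral
      (2 * pi * \<i> * G \<tau> + 2 * pi * \<i> * G (- \<tau>)) / 2) P"
    by (intro has_contour_integral_div has_contour_integral_add cauchy) auto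
  then have "(f has_contour_integral (2 * pi * \<i> * G \<tau> + 2 * pi * \<i> * G (- \<tau>)) / 2) P"
    by (rule has_contour_integral_eq) (use split notin in metis)
  then have total: "contour_integral P f = 2 * pi * \<i> * G \<tau>"
    by (simp add: even contour_integral_unique)
  have integrable: "f contour_integrable_on linepath p q"
    if "closed_segment p q \<subseteq> path_image P" for p q
  proof (rule contour_integrable_continuous_linepath)
    have "t\<^sup>2 - \<tau>\<^sup>2 \<noteq> 0" if "t \<in> path_image P" for t
      using that notin by (auto simp: power2_eq_iff)
    then show "continuous_on (closed_segment p q) f"
      unfolding f_def using that
      by (intro continuous_intros holomorphic_on_imp_continuous_on[OF holomorphic_on_subset[OF G]]) auto
  qed
  define c1 c2 c3 c4 where "c1 = Complex (- R) (- b)" and "c2 = Complex R (- b)"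
    and "c3 = Complex R b" and "c4 = Complex (- R) b"
  have P: "P = linepath c1 c2 +++ linepath c2 c3 +++ linepath c3 c4 +++ linepath c4 c1"
    by (simp add: P_def rectpath_def Let_def c1_def c2_def c3_def c4_def)
  have sides: "f contour_integrable_on linepath c1 c2" "f contour_integrable_on linepath c2 c3"
    "f contour_integrable_on linepath c3 c4" "f contour_integrable_on linepath c4 c1"
    by (rule integrable, force simp: P path_image_join)+
  have odd: "f (- t) = - f t" for t
    by (simp add: f_def even)
  \<comment> \<open>Under t -> -t one sign comes from dt and another from the oddness of
    \<open>f\<close>; they cancel.\<close>
  have opposite: "contour_integral (linepath (- p) (- q)) f = contour_integral (linepath p q) f" for p q
  proof -
    have "linepath (- p) (- q) = uminus \<circ> linepath p q"
      by (auto simp: linepath_def fun_eq_iff algebra_simps)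
    then have "contour_integral (linepath (- p) (- q)) f = - contour_integral (linepath p q) (\<lambda>t. f (- t))"
      by (simp add: contour_integral_negatepath)
    also have "\<dots> = contour_integral (linepath p q) f"
      unfolding odd by (simp add: contour_integral_neg)
    finally show ?thesis .
  qed
  have minus: "c3 = - c1" "c4 = - c2" by (simp_all add: c1_def c2_def c3_def c4_def complex_eq_iff)
  have "contour_integral P f = contour_integral (linepath c1 c2) f + (contour_integral (linepath c2 c3) f
      + (contour_integral (linepath c3 c4) f + contour_integral (linepath c4 c1) f))"
    unfolding P using sides by (simp add: contour_integrable_joinI valid_path_join)
  also have "\<dots> = 2 * (contour_integral (linepath c1 c2) f + contour_integral (linepath c2 c3) f)"
    using opposite[of c1 c2] opposite[of c2 c3] by (simp add: minus)
  finally have "2 * (integral {-R..R} (\<lambda>x. f (Complex x (- b))) +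
      contour_integral (linepath (Complex R (- b)) (Complex R b)) f) = 2 * (of_real pi * \<i> * G \<tau>)"
    using total pos by (simp add: c1_def c2_def c3_def contour_integral_linepath_same_Im algebra_simps)
  then show "integral {-R..R} (\<lambda>x. f (Complex x (- b))) +
      contour_integral (linepath (Complex R (- b)) (Complex R b)) f = of_real pi * \<i> * G \<tau>"
    by (simp only: mult_cancel_left) simp
  show "f contour_integrable_on linepath (Complex R (- b)) (Complex R b)"
    using sides(2) by (simp add: c2_def c3_def)
qed

text \<open>Let the rectangle of \<open>even_cauchy_kernel_rectangle\<close> grow. A vertical side
  has fixed length \<open>2 * b\<close> while the kernel on it is O(1/R), so for bounded
  \<open>G\<close> its contribution vanishes.\<close>

lemma even_cauchy_kernel_line_bounded:
  fixes G :: "complex \<Rightarrow> complex" and b M :: real and \<tau> :: complex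
  assumes G: "G holomorphic_on UNIV" and even: "\<And>t. G (- t) = G t"
    and \<tau>: "\<bar>Im \<tau>\<bar> < b" and M: "\<And>t. \<bar>Im t\<bar> \<le> b \<Longrightarrow> norm (G t) \<le> M"
    and int: "integrable lborel (\<lambda>x. Complex x (- b) * G (Complex x (- b)) / ((Complex x (- b))\<^sup>2 - \<tau>\<^sup>2))"
  shows "(LINT x|lborel. Complex x (- b) * G (Complex x (- b)) / ((Complex x (- b))\<^sup>2 - \<tau>\<^sup>2)) =
    of_real pi * \<i> * G \<tau>"
proof -
  define f where "f = (\<lambda>t. t * G t / (t\<^sup>2 - \<tau>\<^sup>2))"
  define side where "side = (\<lambda>R. contour_integral (linepath (Complex R (- b)) (Complex R b)) f)"
  have "M \<ge> 0" using M[of 0] \<tau> norm_ge_zero[of "G 0"] by (smt (verit) zero_complex.simps(2))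
  have bound: "norm (side R) \<le> M / (R - norm \<tau>) * (2 * b)" if R: "R > norm \<tau>" for R
  proof -
    have "norm (side R) \<le> M / (R - norm \<tau>) * norm (Complex R b - Complex R (- b))"
      unfolding side_def
    proof (rule contour_integral_bound_linepath)
      show "f contour_integrable_on linepath (Complex R (- b)) (Complex R b)"
        unfolding f_def using R abs_Re_le_cmod[of \<tau>]
        by (intro even_cauchy_kernel_rectangle(2) G even \<tau>) auto
      fix t assume "t \<in> closed_segment (Complex R (- b)) (Complex R b)"
      then have t: "Re t = R" "\<bar>Im t\<bar> \<le> b"
        using \<tau> by (auto simp: closed_segment_same_Re closed_segment_eq_real_ivl split: if_splits)
      have far: "norm (t - z) \<ge> R - norm \<tau>" if "norm z = norm \<tau>" for z
        using norm_triangle_ineq2[of t z] abs_Re_le_cmod[of t] t that by linarith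
      have "norm (t / (t\<^sup>2 - \<tau>\<^sup>2)) * norm (G t) \<le> 1 / (R - norm \<tau>) * M"
        using R far[of \<tau>] far[of "- \<tau>"] t M[of t] by (intro mult_mono norm_symmetric_kernel_le(1)) auto
      then show "norm (f t) \<le> M / (R - norm \<tau>)"
        by (simp add: f_def norm_mult norm_divide)
    qed (use R \<open>M \<ge> 0\<close> in auto)
    also have "norm (Complex R b - Complex R (- b)) = 2 * b"
      using \<tau> by (simp add: cmod_def real_sqrt_mult)
    finally show ?thesis .
  qed
  have "(side \<longlongrightarrow> 0) at_top"
  proof (rule Lim_null_comparison)
    show "\<forall>\<^sub>F R in at_top. norm (side R) \<le> M / (R - norm \<tau>) * (2 * b)"
      using eventually_gt_at_top[of "norm \<tau>"] by eventually_elim (rule bound)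
    show "((\<lambda>R. M / (R - norm \<tau>) * (2 * b)) \<longlongrightarrow> 0) at_top"
      by real_asymp
  qed
  from tendsto_add[OF integral_symmetric_interval_tendsto[OF int] this]
  have "((\<lambda>R. integral {-R..R} (\<lambda>x. f (Complex x (- b))) + side R) \<longlongrightarrow>
      (LINT x|lborel. f (Complex x (- b)))) at_top"
    by (simp add: f_def)
  moreover have "\<forall>\<^sub>F R in at_top. integral {-R..R} (\<lambda>x. f (Complex x (- b))) + side R = of_real pi * \<i> * G \<tau>"
    using eventually_gt_at_top[of "\<bar>Re \<tau>\<bar>"]
    by eventually_elim (use even_cauchy_kernel_rectangle(1)[OF G even \<tau>] in \<open>simp add: f_def side_def\<close>)
  ultimately have "((\<lambda>R. of_real pi * \<i> * G \<tau>) \<longlongrightarrow> (LINT x|lborel. f (Complex x (- b)))) (at_top :: real filter)"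
    by (simp cong: tendsto_cong)
  then show ?thesis
    by (simp add: f_def tendsto_const_iff)
qed

text \<open>Multiplying by \<open>exp (- \<epsilon> t\<^sup>2)\<close> keeps the function even and entire and makes it bounded on the
  strip, so that no decay of \<open>G\<close> inside the strip is needed; \<open>\<epsilon>\<close> then tends to 0.\<close>

lemma even_cauchy_kernel_line:
  fixes G :: "complex \<Rightarrow> complex" and b C :: real and \<tau> :: complex
  assumes G: "G holomorphic_on UNIV" and even: "\<And>t. G (- t) = G t"
    and \<tau>: "\<bar>Im \<tau>\<bar> < b" and C: "\<And>t. \<bar>Im t\<bar> \<le> b \<Longrightarrow> norm (G t) \<le> C * (1 + norm t)\<^sup>2"
    and int: "integrable lborel (\<lambda>x. Complex x (- b) * G (Complex x (- b)) / ((Complex x (- b))\<^sup>2 - \<tau>\<^sup>2))"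
  shows "(LINT x|lborel. Complex x (- b) * G (Complex x (- b)) / ((Complex x (- b))\<^sup>2 - \<tau>\<^sup>2)) =
    of_real pi * \<i> * G \<tau>"
proof -
  define e where "e = (\<lambda>n. inverse (real (Suc n)))"
  define D where "D = (\<lambda>n t. exp (- (of_real (e n) * t\<^sup>2)) :: complex)"
  define f where "f = (\<lambda>x. Complex x (- b) * G (Complex x (- b)) / ((Complex x (- b))\<^sup>2 - \<tau>\<^sup>2))"
  \<comment> \<open>The bound \<open>e n \<le> 1\<close> keeps the growing factor
    \<open>exp (e n * (Im t)\<^sup>2)\<close> below \<open>exp (b\<^sup>2)\<close>, which makes the
    majorant for the limit independent of n.\<close>
  have e: "0 < e n" "e n \<le> 1" for n by (auto simp: e_def field_simps)
  have D_lim: "(\<lambda>n. D n t) \<longlonglongrightarrow> 1" for t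
  proof -
    have "e \<longlonglongrightarrow> 0" unfolding e_def by (rule LIMSEQ_inverse_real_of_nat)
    then have "(\<lambda>n. D n t) \<longlonglongrightarrow> exp (- (of_real 0 * t\<^sup>2))"
      unfolding D_def by (intro tendsto_intros)
    then show ?thesis by simp
  qed
  have norm_D: "norm (D n t) = exp (e n * (Im t)\<^sup>2) * exp (- (e n * (Re t)\<^sup>2))" for n t
    by (simp add: D_def norm_exp_eq_Re power2_eq_square algebra_simps flip: exp_add)
  have D_bound: "norm (D n t) \<le> exp (b\<^sup>2) * exp (- (e n * (Re t)\<^sup>2))" if "\<bar>Im t\<bar> \<le> b" for n t
  proof -
    have "(Im t)\<^sup>2 \<le> b\<^sup>2" using that by (metis abs_le_square_iff abs_of_nonneg abs_ge_zero order_trans)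
    then have "e n * (Im t)\<^sup>2 \<le> 1 * b\<^sup>2" using e[of n] by (intro mult_mono) auto
    then show ?thesis by (simp add: norm_D)
  qed
  have [measurable]: "f \<in> borel_measurable borel"
    using int by (simp add: borel_measurable_integrable f_def flip: measurable_lborel1)
  have [measurable]: "(\<lambda>x. D n (Complex x (- b))) \<in> borel_measurable borel" for n
    unfolding D_def Complex_eq by (intro borel_measurable_continuous_onI continuous_intros)
  have bound: "norm (f x * D n (Complex x (- b))) \<le> exp (b\<^sup>2) * norm (f x)" for n x
  proof -
    have "norm (D n (Complex x (- b))) \<le> exp (b\<^sup>2) * exp (- (e n * x\<^sup>2))"
      using D_bound[of "Complex x (- b)" n] \<tau> by simp
    also have "\<dots> \<le> exp (b\<^sup>2)" using e(1)[of n] by (simp add: less_imp_le)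
    finally show ?thesis by (simp add: norm_mult mult.commute[of "exp _"] mult_left_mono)
  qed
  have dom: "integrable lborel (\<lambda>x. exp (b\<^sup>2) * norm (f x))"
    using int by (simp add: f_def)
  have "(LINT x|lborel. f x * D n (Complex x (- b))) = of_real pi * \<i> * (G \<tau> * D n \<tau>)" for n
  proof -
    \<comment> \<open>The summand \<open>2 / e n\<close> absorbs \<open>2 * x\<^sup>2\<close> in
      \<open>K * (1 + e n * x\<^sup>2)\<close>, after which the Gaussian factor cancels the
      quadratic growth. \<open>K\<close> may depend on n, since boundedness is needed only for each
      fixed n.\<close>
    define K where "K = 2 * (1 + b)\<^sup>2 + 2 / e n"
    have "C \<ge> 0" using order_trans[OF norm_ge_zero C[of 0]] \<tau> by simp
    have GD: "norm (G t * D n t) \<le> C * K * exp (b\<^sup>2)" if t: "\<bar>Im t\<bar> \<le> b" for t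
    proof -
      define x where "x = \<bar>Re t\<bar>"
      have "norm t \<le> x + b" using cmod_le[of t] t by (simp add: x_def)
      then have "(1 + norm t)\<^sup>2 \<le> ((1 + b) + x)\<^sup>2" by (intro power_mono) auto
      also have "\<dots> \<le> 2 * (1 + b)\<^sup>2 + 2 * x\<^sup>2"
        using sum_squares_bound[of "1 + b" x] by (simp add: power2_sum)
      also have "\<dots> \<le> K * (1 + e n * x\<^sup>2)"
        using e(1)[of n] by (simp add: K_def algebra_simps)
      also have "\<dots> \<le> K * exp (e n * x\<^sup>2)"
        using e(1)[of n] by (intro mult_left_mono exp_ge_add_one_self) (simp add: K_def)
      finally have quad: "(1 + norm t)\<^sup>2 \<le> K * exp (e n * x\<^sup>2)" .
      have "norm (G t * D n t) \<le> (C * (1 + norm t)\<^sup>2) * (exp (b\<^sup>2) * exp (- (e n * x\<^sup>2)))"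
        unfolding norm_mult using C[OF t] D_bound[OF t] \<open>C \<ge> 0\<close> by (intro mult_mono) (auto simp: x_def)
      also have "\<dots> \<le> (C * (K * exp (e n * x\<^sup>2))) * (exp (b\<^sup>2) * exp (- (e n * x\<^sup>2)))"
        by (intro mult_right_mono mult_left_mono) (use \<open>C \<ge> 0\<close> quad in auto)
      also have "\<dots> = C * K * exp (b\<^sup>2)" by (simp add: exp_minus field_simps)
      finally show ?thesis .
    qed
    have eq: "f x * D n (Complex x (- b)) = Complex x (- b) * (G (Complex x (- b)) * D n (Complex x (- b))) /
        ((Complex x (- b))\<^sup>2 - \<tau>\<^sup>2)" for x
      by (simp add: f_def)
    have "integrable lborel (\<lambda>x. f x * D n (Complex x (- b)))"
      using dom by (rule Bochner_Integration.integrable_bound) (use bound in \<open>auto intro!: AE_I2\<close>)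
    then show ?thesis
      unfolding eq by (intro even_cauchy_kernel_line_bounded[OF _ _ \<tau> GD])
        (auto simp: D_def even intro!: holomorphic_intros G)
  qed
  moreover have "(\<lambda>n. LINT x|lborel. f x * D n (Complex x (- b))) \<longlonglongrightarrow> (LINT x|lborel. f x)"
  proof (rule integral_dominated_convergence[OF _ _ dom])
    show "AE x in lborel. (\<lambda>n. f x * D n (Complex x (- b))) \<longlonglongrightarrow> f x"
      using tendsto_mult[OF tendsto_const D_lim] by simp
  qed (use bound in auto)
  moreover have "(\<lambda>n. of_real pi * \<i> * (G \<tau> * D n \<tau>)) \<longlonglongrightarrow> of_real pi * \<i> * G \<tau>"
    by (rule tendsto_eq_intros refl D_lim)+ simp
  ultimately show ?thesis
    by (auto simp: f_def intro: LIMSEQ_unique)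
qed

section \<open>Inversion of the theta series\<close>

text \<open>The even exponent makes the weight nonnegative and 1-periodic, although the cosine
  itself changes sign under y -> y + 1.\<close>

definition cos_weight :: "nat \<Rightarrow> real" where
  "cos_weight N = integral {- (1/2)..1/2} (\<lambda>y. cos (pi * y) ^ (2 * N))"

text \<open>Average over one period against a probability density that concentrates at 0 as N grows.
  At the function cos (2 pi j y) it yields the Fourier coefficients of that density.\<close>

definition cos_mean :: "nat \<Rightarrow> (real \<Rightarrow> real) \<Rightarrow> real" where
  "cos_mean N f = integral {- (1/2)..1/2} (\<lambda>y. f y * cos (pi * y) ^ (2 * N)) / cos_weight N"

lemma integrable_times_cos_power:
  fixes f :: "real \<Rightarrow> real"
  assumes "continuous_on {- (1/2)..1/2} f"
  shows "(\<lambda>y. f y * cos (pi * y) ^ k) integrable_on {- (1/2)..1/2}"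
  by (intro integrable_continuous_interval continuous_intros assms)

text \<open>Integration by parts: the difference of the integrands is the derivative of
  \<open>cos (pi * y) ^ (2 * N + 1) * sin (pi * y) / pi\<close>, which vanishes at both ends. The
  recursion stands in for a closed form of the integral.\<close>

lemma cos_weight_Suc: "(2 * real N + 2) * cos_weight (Suc N) = (2 * real N + 1) * cos_weight N"
proof -
  let ?c = "\<lambda>y. cos (pi * y)"
  let ?F = "\<lambda>y. ?c y ^ (2 * N + 1) * sin (pi * y) / pi"
  have int: "(\<lambda>y. ?c y ^ k) integrable_on {- (1/2)..1/2}" for k
    by (intro integrable_continuous_interval continuous_intros)
  have "((\<lambda>y. (2 * real N + 2) * ?c y ^ (2 * Suc N) - (2 * real N + 1) * ?c y ^ (2 * N))
      has_integral ?F (1/2) - ?F (- (1/2))) {- (1/2)..1/2}"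
  proof (rule fundamental_theorem_of_calculus)
    fix y :: real
    have "(?F has_real_derivative
        ?c y ^ (2 * N + 1) * ?c y - (2 * real N + 1) * ?c y ^ (2 * N) * (sin (pi * y))\<^sup>2)
        (at y within {- (1/2)..1/2})"
      by (rule derivative_eq_intros refl | simp)+ (simp add: power2_eq_square field_simps)
    also have "?c y ^ (2 * N + 1) * ?c y - (2 * real N + 1) * ?c y ^ (2 * N) * (sin (pi * y))\<^sup>2 =
        (2 * real N + 2) * ?c y ^ (2 * Suc N) - (2 * real N + 1) * ?c y ^ (2 * N)"
      unfolding sin_squared_eq by (simp add: power2_eq_square algebra_simps)
    finally show "(?F has_vector_derivative
        (2 * real N + 2) * ?c y ^ (2 * Suc N) - (2 * real N + 1) * ?c y ^ (2 * N)) (at y within {- (1/2)..1/2})"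
      by (simp add: has_real_derivative_iff_has_vector_derivative)
  qed simp
  moreover have "((\<lambda>y. (2 * real N + 2) * ?c y ^ (2 * Suc N) - (2 * real N + 1) * ?c y ^ (2 * N))
      has_integral (2 * real N + 2) * cos_weight (Suc N) - (2 * real N + 1) * cos_weight N) {- (1/2)..1/2}"
    unfolding cos_weight_def by (intro has_integral_diff has_integral_mult_right integrable_integral int)
  ultimately have "(2 * real N + 2) * cos_weight (Suc N) - (2 * real N + 1) * cos_weight N = ?F (1/2) - ?F (- (1/2))"
    by (rule has_integral_unique[symmetric])
  then show ?thesis by (simp add: cos_pi_half)
qed

lemma cos_weight_pos: "cos_weight N > 0"
proof (induction N)
  case 0
  show ?case by (simp add: cos_weight_def)
next
  case (Suc N)
  then show ?case
    using cos_weight_Suc[of N] by (smt (verit) mult_pos_pos of_nat_0_le_iff zero_less_mult_pos)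
qed

lemma cos_mean_diff:
  assumes "continuous_on {- (1/2)..1/2} f" "continuous_on {- (1/2)..1/2} g"
  shows "cos_mean N (\<lambda>y. f y - g y) = cos_mean N f - cos_mean N g"
  using assms by (simp add: cos_mean_def left_diff_distrib Henstock_Kurzweil_Integration.integral_diff integrable_times_cos_power diff_divide_distrib)

lemma cos_mean_const: "cos_mean N (\<lambda>y. c) = c"
  using cos_weight_pos[of N] by (simp add: cos_mean_def cos_weight_def)

lemma cos_mean_abs_le:
  assumes f: "continuous_on {- (1/2)..1/2} f" and g: "continuous_on {- (1/2)..1/2} g"
    and le: "\<And>y. y \<in> {- (1/2)..1/2} \<Longrightarrow> \<bar>f y\<bar> \<le> g y"
  shows "\<bar>cos_mean N f\<bar> \<le> cos_mean N g"
proof -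
  have "norm (integral {- (1/2)..1/2} (\<lambda>y. f y * cos (pi * y) ^ (2 * N)))
      \<le> integral {- (1/2)..1/2} (\<lambda>y. g y * cos (pi * y) ^ (2 * N))"
    using le by (intro integral_norm_bound_integral integrable_times_cos_power f g)
      (simp add: abs_mult mult_right_mono)
  then show ?thesis
    using cos_weight_pos[of N] by (simp add: cos_mean_def divide_right_mono)
qed

text \<open>By \<open>cos_weight_Suc\<close> the mean of cos^2 (pi y) is (2 N + 1) / (2 N + 2). Its
  complement tends to 0 and measures how the weight concentrates at 0.\<close>

lemma cos_mean_sin_squared: "cos_mean N (\<lambda>y. (sin (pi * y))\<^sup>2) = 1 / (2 * real N + 2)"
proof -
  have "cos_mean N (\<lambda>y. (sin (pi * y))\<^sup>2) = cos_mean N (\<lambda>y. 1 - (cos (pi * y))\<^sup>2)"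
    by (simp add: sin_squared_eq)
  also have "\<dots> = 1 - cos_mean N (\<lambda>y. (cos (pi * y))\<^sup>2)"
    by (subst cos_mean_diff) (auto intro!: continuous_intros simp: cos_mean_const)
  also have "cos_mean N (\<lambda>y. (cos (pi * y))\<^sup>2) = cos_weight (Suc N) / cos_weight N"
    by (simp add: cos_mean_def cos_weight_def[of "Suc N"] power_add[symmetric])
  finally have "cos_mean N (\<lambda>y. (sin (pi * y))\<^sup>2) = 1 - cos_weight (Suc N) / cos_weight N" .
  moreover have "(2 * real N + 2) * (cos_weight (Suc N) / cos_weight N) = 2 * real N + 1"
    using cos_weight_Suc[of N] cos_weight_pos[of N] by simp
  moreover have "1 - q = 1 / (2 * x + 2)" if "x \<ge> 0" "(2 * x + 2) * q = 2 * x + 1" for x q :: real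
    using that by (simp add: field_simps)
  ultimately show ?thesis by simp
qed

text \<open>Korovkin's argument: away from 0 the oscillation of \<open>f\<close> is dominated by a multiple of
  \<open>sin\<^sup>2 (\<pi> y)\<close>, whose means tend to 0.\<close>

lemma cos_mean_tendsto:
  assumes f: "continuous_on {- (1/2)..1/2} f"
  shows "(\<lambda>N. cos_mean N f) \<longlonglongrightarrow> f 0"
proof (rule LIMSEQ_I)
  fix e :: real assume e: "e > 0"
  have "bounded (f ` {- (1/2)..1/2})"
    by (intro compact_imp_bounded compact_continuous_image f compact_Icc)
  then obtain M where M: "\<And>y. y \<in> {- (1/2)..1/2} \<Longrightarrow> \<bar>f y\<bar> \<le> M"
    unfolding bounded_iff by (metis image_eqI real_norm_def)
  have "M \<ge> 0" using M[of 0] by simp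
  obtain d where d: "d > 0" "\<And>y. y \<in> {- (1/2)..1/2} \<Longrightarrow> \<bar>y\<bar> < d \<Longrightarrow> \<bar>f y - f 0\<bar> < e / 2"
    using f[unfolded continuous_on_iff, rule_format, of 0 "e / 2"] e
    unfolding dist_real_def diff_0_right by (metis atLeastAtMost_iff half_gt_zero neg_le_0_iff_le
      zero_le_divide_1_iff zero_le_numeral)
  \<comment> \<open>The cap 1/2 keeps \<open>pi * d'\<close> within [0, pi/2], where the sine
    increases. The constant \<open>C\<close> below is chosen so that
    \<open>C * (sin (pi * y))\<^sup>2\<close> reaches \<open>2 * M\<close>, the largest possible
    oscillation of \<open>f\<close>, once \<open>\<bar>y\<bar> \<ge> d'\<close>.\<close>
  define d' where "d' = min d (1/2)"
  define C where "C = 2 * M / (sin (pi * d'))\<^sup>2"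
  have d': "d' > 0" "d' \<le> 1/2" "d' \<le> d" using d by (auto simp: d'_def)
  have s: "sin (pi * d') > 0" using d' by (intro sin_gt_zero) (auto simp: field_simps)
  have "C \<ge> 0" using \<open>M \<ge> 0\<close> by (simp add: C_def)
  have dominated: "\<bar>f y - f 0\<bar> \<le> e / 2 + C * (sin (pi * y))\<^sup>2" if y: "y \<in> {- (1/2)..1/2}" for y
  proof (cases "\<bar>y\<bar> < d'")
    case True
    then show ?thesis using d(2)[OF y] d' \<open>C \<ge> 0\<close> by (smt (verit) mult_nonneg_nonneg zero_le_power2)
  next
    case False
    have "sin (pi * d') \<le> sin (pi * \<bar>y\<bar>)"
    proof (rule sin_monotone_2pi_le)
      show "- (pi / 2) \<le> pi * d'" using d' pi_gt_zero by (smt (verit) divide_pos_pos mult_pos_pos)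
      show "pi * \<bar>y\<bar> \<le> pi / 2" using y by (auto simp: field_simps abs_le_iff)
    qed (use False in simp)
    then have "(sin (pi * d'))\<^sup>2 \<le> (sin (pi * \<bar>y\<bar>))\<^sup>2" using s by (intro power_mono) auto
    also have "\<dots> = (sin (pi * y))\<^sup>2" by (cases "y \<ge> 0") auto
    finally have "C * (sin (pi * d'))\<^sup>2 \<le> C * (sin (pi * y))\<^sup>2"
      using \<open>C \<ge> 0\<close> by (rule mult_left_mono)
    moreover have "C * (sin (pi * d'))\<^sup>2 = 2 * M" using s by (simp add: C_def)
    ultimately show ?thesis using M[OF y] M[of 0] e by auto
  qed
  have bound: "\<bar>cos_mean N f - f 0\<bar> \<le> e / 2 + C * (1 / (2 * real N + 2))" for N
  proof -
    have "cos_mean N f - f 0 = cos_mean N (\<lambda>y. f y - f 0)"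
      by (simp add: cos_mean_diff f cos_mean_const)
    also have "\<bar>\<dots>\<bar> \<le> cos_mean N (\<lambda>y. e / 2 + C * (sin (pi * y))\<^sup>2)"
      by (intro cos_mean_abs_le continuous_intros f dominated)
    also have "\<dots> = cos_mean N (\<lambda>y. e / 2 - (- C) * (sin (pi * y))\<^sup>2)" by simp
    also have "\<dots> = e / 2 - cos_mean N (\<lambda>y. (- C) * (sin (pi * y))\<^sup>2)"
      by (subst cos_mean_diff) (auto intro!: continuous_intros simp: cos_mean_const)
    also have "cos_mean N (\<lambda>y. (- C) * (sin (pi * y))\<^sup>2) = (- C) * cos_mean N (\<lambda>y. (sin (pi * y))\<^sup>2)"
      by (simp add: cos_mean_def mult.assoc)
    finally show ?thesis by (simp add: cos_mean_sin_squared)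
  qed
  have "(\<lambda>N. e / 2 + C * (1 / (2 * real N + 2))) \<longlonglongrightarrow> e / 2"
    by real_asymp
  from order_tendstoD(2)[OF this, of e] e
  have "\<forall>\<^sub>F N in sequentially. e / 2 + C * (1 / (2 * real N + 2)) < e"
    by simp
  then obtain n0 where "\<And>N. N \<ge> n0 \<Longrightarrow> e / 2 + C * (1 / (2 * real N + 2)) < e"
    unfolding eventually_sequentially by blast
  with bound show "\<exists>n0. \<forall>N\<ge>n0. norm (cos_mean N f - f 0) < e"
    by (metis le_less_trans real_norm_def)
qed

section \<open>Gaussian Fourier integrals and the cosine expansion of the weight\<close>

text \<open>The real part of the characteristic function of the standard normal distribution, after
  a linear change of variable.\<close>

lemma has_bochner_integral_gaussian_cos:
  fixes a k :: real
  assumes a: "a > 0"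
  shows "has_bochner_integral lborel (\<lambda>y. exp (- (pi * a * y\<^sup>2)) * cos (2 * pi * k * y))
    (exp (- (pi * k\<^sup>2 / a)) / sqrt a)"
proof -
  \<comment> \<open>The substitution x = c y turns exp (-x^2 / 2) into exp (-pi a y^2), and
    \<open>t\<close> is chosen so that t x becomes 2 pi k y.\<close>
  define c t where "c = sqrt (2 * pi * a)" and "t = 2 * pi * k / c"
  have c: "c > 0" "c\<^sup>2 = 2 * pi * a" using a by (auto simp: c_def)
  let ?f = "\<lambda>x. std_normal_density x *\<^sub>R cis (t * x)"
  have [measurable]: "(\<lambda>x. cis (t * x)) \<in> borel_measurable borel"
    by (intro borel_measurable_continuous_onI continuous_intros)
  have "integrable std_normal_distribution (\<lambda>x. cis (t * x))"
    by (rule finite_measure.integrable_const_bound[where B = 1])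
      (auto intro!: prob_space.axioms(1) prob_space_normal_density)
  then have int: "integrable lborel ?f"
    by (simp add: integrable_density normal_density_nonneg)
  have "complex_of_real (exp (- (t^2) / 2)) = (LINT x|std_normal_distribution. cis (t * x))"
    using char_std_normal_distribution[THEN fun_cong, of t] by (simp only: char_def cis_conv_exp)
  also have "\<dots> = (LINT x|lborel. ?f x)"
    by (subst integral_density) (auto simp: normal_density_nonneg)
  finally have "has_bochner_integral lborel ?f (complex_of_real (exp (- (t^2) / 2)))"
    using int by (simp add: has_bochner_integral_iff)
  from has_bochner_integral_Re[OF this]
  have "has_bochner_integral lborel (\<lambda>x. std_normal_density x * cos (t * x)) (exp (- (t^2) / 2))"
    by simp
  from lborel_has_bochner_integral_real_affine_iff[THEN iffD1, OF _ this, of c 0]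
  have "has_bochner_integral lborel (\<lambda>y. std_normal_density (c * y) * cos (t * (c * y))) (exp (- (t^2) / 2) / c)"
    using c by (simp add: field_simps)
  note has_bochner_integral_mult_right[OF this, of "sqrt (2 * pi)"]
  moreover have "sqrt (2 * pi) * (std_normal_density (c * y) * cos (t * (c * y))) =
      exp (- (pi * a * y\<^sup>2)) * cos (2 * pi * k * y)" for y
    using a c by (simp add: std_normal_density_def t_def power_mult_distrib mult_ac)
  moreover have "t\<^sup>2 / 2 = pi * k\<^sup>2 / a"
    using a c by (simp add: t_def power_divide power_mult_distrib power2_eq_square)
  then have "sqrt (2 * pi) * (exp (- (t\<^sup>2) / 2) / c) = exp (- (pi * k\<^sup>2 / a)) / sqrt a"
    using a by (simp add: c_def real_sqrt_mult)
  ultimately show ?thesis by (simp only:)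
qed

lemma integral_cos_full_period:
  "integral {- (1/2)..1/2} (\<lambda>y. cos (2 * pi * of_int m * y)) = (if m = 0 then 1 else 0 :: real)"
proof (cases "m = 0")
  case False
  have "((\<lambda>y. cos (2 * pi * of_int m * y)) has_integral
      sin (2 * pi * of_int m * (1/2)) / (2 * pi * of_int m) -
      sin (2 * pi * of_int m * - (1/2)) / (2 * pi * of_int m)) {- (1/2)..1/2}"
    using False
    by (intro fundamental_theorem_of_calculus)
      (auto intro!: derivative_eq_intros simp flip: has_real_derivative_iff_has_vector_derivative)
  moreover have "sin (pi * of_int m) = 0" by (simp add: mult.commute)
  ultimately show ?thesis using False by (simp add: integral_unique)
qed simp

lemma integral_cos_mult_cos:
  fixes i j :: nat
  shows "integral {- (1/2)..1/2} (\<lambda>y. cos (2 * pi * real i * y) * cos (2 * pi * real j * y)) =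
    (if i = j then if i = 0 then 1 else 1/2 else 0)"
proof -
  have eq: "cos (2 * pi * real i * y) * cos (2 * pi * real j * y) =
      (cos (2 * pi * of_int (int i - int j) * y) + cos (2 * pi * of_int (int i + int j) * y)) / 2" for y
    by (simp add: cos_times_cos algebra_simps)
  have int: "(\<lambda>y. cos (2 * pi * of_int m * y)) integrable_on {- (1/2)..1/2 :: real}" for m
    by (intro integrable_continuous_interval continuous_intros)
  have "integral {- (1/2)..1/2} (\<lambda>y. cos (2 * pi * real i * y) * cos (2 * pi * real j * y)) =
     (integral {- (1/2)..1/2} (\<lambda>y. cos (2 * pi * of_int (int i - int j) * y)) +
      integral {- (1/2)..1/2} (\<lambda>y. cos (2 * pi * of_int (int i + int j) * y))) / 2"
    unfolding eq using int by (simp only: integral_divide Henstock_Kurzweil_Integration.integral_add)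
  then show ?thesis
    by (simp only: integral_cos_full_period) auto
qed

text \<open>Passing from N to N + 1 multiplies by cos^2 (pi y) = (1 + cos (2 pi y)) / 2, which sends
  the j-th cosine to half of itself plus a quarter of each neighbour.\<close>

lemma cos_power_expansion:
  "\<exists>c. \<forall>y. cos (pi * y) ^ (2 * N) = (\<Sum>j\<le>N. c j * cos (2 * pi * real j * y))"
proof (induction N)
  case 0
  show ?case by (intro exI[of _ "\<lambda>_. 1"]) simp
next
  case (Suc N)
  then obtain c where c: "\<And>y. cos (pi * y) ^ (2 * N) = (\<Sum>j\<le>N. c j * cos (2 * pi * real j * y))"
    by blast
  let ?C = "\<lambda>j y. cos (2 * pi * real j * y)"
  \<comment> \<open>At j = 0 the lower neighbour has index -1; since the cosine is even, it is the
    first cosine again.\<close>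
  have step: "?C j y * (cos (pi * y))\<^sup>2 = ?C j y / 2 + ?C (Suc j) y / 4 + (if j = 0 then ?C 1 y else ?C (j - 1) y) / 4"
    for j y
  proof -
    define X where "X = (if j = 0 then ?C 1 y else ?C (j - 1) y)"
    have "?C j y * cos (2 * pi * y) = (?C (Suc j) y + X) / 2"
      unfolding X_def by (cases j) (simp_all add: cos_times_cos algebra_simps)
    then have "?C j y * ((1 + cos (2 * pi * y)) / 2) = ?C j y / 2 + ?C (Suc j) y / 4 + X / 4"
      by (simp only: times_divide_eq_right distrib_left mult_1_right) (simp add: add_divide_distrib)
    moreover have "(cos (pi * y))\<^sup>2 = (1 + cos (2 * pi * y)) / 2"
      using cos_double_cos[of "pi * y"] by (simp add: mult.assoc)
    ultimately show ?thesis by (simp only: X_def)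
  qed
  \<comment> \<open>Contributions to index j, in order: from j itself, from j - 1, the reflected one
    from 0 to 1, and from j + 1.\<close>
  define c' where "c' = (\<lambda>j.
      (if j \<le> N then c j / 2 else 0) + (if j = 0 then 0 else c (j - 1) / 4) +
       (if j = 1 then c 0 / 4 else 0) + (if j < N then c (Suc j) / 4 else 0))"
  have "cos (pi * y) ^ (2 * Suc N) = (\<Sum>j\<le>Suc N. c' j * ?C j y)" for y
  proof -
    have "cos (pi * y) ^ (2 * Suc N) = (\<Sum>j\<le>N. c j * (?C j y * (cos (pi * y))\<^sup>2))"
    proof -
      have "cos (pi * y) ^ (2 * Suc N) = cos (pi * y) ^ (2 * N) * (cos (pi * y))\<^sup>2"
        by (simp add: power2_eq_square mult_ac)
      then show ?thesis by (simp only: c sum_distrib_right mult.assoc)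
    qed
    also have "\<dots> = (\<Sum>j\<le>N. c j / 2 * ?C j y) + (\<Sum>j\<le>N. c j / 4 * ?C (Suc j) y) +
        (\<Sum>j\<le>N. c j / 4 * (if j = 0 then ?C 1 y else ?C (j - 1) y))"
    proof -
      have "x * (p / 2 + q / 4 + r / 4) = x / 2 * p + x / 4 * q + x / 4 * r" for x p q r :: real
        by (simp add: algebra_simps)
      then show ?thesis by (simp only: step sum.distrib)
    qed
    also have "(\<Sum>j\<le>N. c j / 2 * ?C j y) = (\<Sum>j\<le>Suc N. (if j \<le> N then c j / 2 else 0) * ?C j y)"
      by simp
    also have "(\<Sum>j\<le>N. c j / 4 * ?C (Suc j) y) = (\<Sum>j\<le>Suc N. (if j = 0 then 0 else c (j - 1) / 4) * ?C j y)"
      by (simp only: sum.atMost_Suc_shift) simp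
    also have "(\<Sum>j\<le>N. c j / 4 * (if j = 0 then ?C 1 y else ?C (j - 1) y)) =
        c 0 / 4 * ?C 1 y + (\<Sum>j<N. c (Suc j) / 4 * ?C j y)"
      by (simp only: sum.atMost_shift) simp
    also have "c 0 / 4 * ?C 1 y = (\<Sum>j\<le>Suc N. (if j = 1 then c 0 / 4 else 0) * ?C j y)"
      by (simp add: if_distrib[of "\<lambda>x. x * _"] cong: if_cong)
    also have "(\<Sum>j<N. c (Suc j) / 4 * ?C j y) = (\<Sum>j\<le>Suc N. (if j < N then c (Suc j) / 4 else 0) * ?C j y)"
      by (intro sum.mono_neutral_cong_left) auto
    finally show ?thesis
      by (simp only: c'_def sum.distrib distrib_right add.assoc)
  qed
  then show ?case by (intro exI[of _ c'] allI)
qed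

text \<open>The weight is a finite cosine sum, and each cosine integrates against the Gaussian in
  closed form. The sum over j has finitely many nonzero terms but is written as a series, so that N
  can tend to infinity in it by Tannery's theorem.\<close>

lemma has_bochner_integral_gaussian_cos_power:
  fixes a :: real
  assumes a: "a > 0"
  shows "has_bochner_integral lborel (\<lambda>y. exp (- (pi * a * y\<^sup>2)) * cos (pi * y) ^ (2 * N))
    (cos_weight N * ((1 + 2 * (\<Sum>j. cos_mean N (\<lambda>y. cos (2 * pi * real (Suc j) * y)) *
      exp (- (pi * (real (Suc j))\<^sup>2 / a)))) / sqrt a))"
proof -
  let ?C = "\<lambda>j y. cos (2 * pi * real j * y)"
  let ?e = "\<lambda>j. exp (- (pi * (real j)\<^sup>2 / a))"
  obtain c where c: "\<And>y. cos (pi * y) ^ (2 * N) = (\<Sum>j\<le>N. c j * ?C j y)"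
    using cos_power_expansion by blast
  \<comment> \<open>Orthogonality recovers the coefficients of any cosine expansion as means, so
    \<open>cos_power_expansion\<close> need not give them explicitly. The factor 1/2 off index 0
    becomes the 2 in front of the series.\<close>
  have coeff: "cos_weight N * cos_mean N (?C i) = (if i \<le> N then c i * (if i = 0 then 1 else 1/2) else 0)" for i
  proof -
    have int: "(\<lambda>y. c j * (?C i y * ?C j y)) integrable_on {- (1/2)..1/2}" for j
      by (intro integrable_continuous_interval continuous_intros)
    have "cos_weight N * cos_mean N (?C i) = integral {- (1/2)..1/2} (\<lambda>y. ?C i y * cos (pi * y) ^ (2 * N))"
      using cos_weight_pos[of N] by (simp add: cos_mean_def)
    also have "\<dots> = integral {- (1/2)..1/2} (\<lambda>y. \<Sum>j\<le>N. c j * (?C i y * ?C j y))"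
      unfolding c sum_distrib_left by (simp only: mult.left_commute)
    also have "\<dots> = (\<Sum>j\<le>N. c j * integral {- (1/2)..1/2} (\<lambda>y. ?C i y * ?C j y))"
      using int by (subst integral_sum) auto
    also have "\<dots> = (\<Sum>j\<le>N. if i = j then c i * (if i = 0 then 1 else 1/2) else 0)"
      by (intro sum.cong refl) (simp only: integral_cos_mult_cos, simp)
    finally show ?thesis by simp
  qed
  have "has_bochner_integral lborel (\<lambda>y. \<Sum>j\<le>N. c j * (exp (- (pi * a * y\<^sup>2)) * ?C j y))
      (\<Sum>j\<le>N. c j * (?e j / sqrt a))"
    by (intro has_bochner_integral_sum has_bochner_integral_mult_right has_bochner_integral_gaussian_cos a)
  moreover have "(\<Sum>j\<le>N. c j * (exp (- (pi * a * y\<^sup>2)) * ?C j y)) = exp (- (pi * a * y\<^sup>2)) * cos (pi * y) ^ (2 * N)" for y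
    by (simp only: c sum_distrib_left mult.left_commute)
  moreover have "(\<Sum>j\<le>N. c j * (?e j / sqrt a)) =
      cos_weight N * ((1 + 2 * (\<Sum>j. cos_mean N (?C (Suc j)) * ?e (Suc j))) / sqrt a)"
  proof -
    have "cos_mean N (?C 0) = 1" by (simp add: cos_mean_const)
    then have c0: "c 0 = cos_weight N" using coeff[of 0] by simp
    have cj: "c (Suc j) = 2 * cos_weight N * cos_mean N (?C (Suc j))" if "j < N" for j
      using coeff[of "Suc j"] that by simp
    \<comment> \<open>Means of cosines beyond the degree N vanish, which truncates the
      series.\<close>
    have "cos_mean N (?C (Suc j)) = 0" if "j \<ge> N" for j
      using coeff[of "Suc j"] cos_weight_pos[of N] that by simp
    then have "(\<Sum>j. cos_mean N (?C (Suc j)) * ?e (Suc j)) = (\<Sum>j<N. cos_mean N (?C (Suc j)) * ?e (Suc j))"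
      by (intro suminf_finite) auto
    moreover have "(\<Sum>j\<le>N. c j * (?e j / sqrt a)) = cos_weight N / sqrt a +
        (\<Sum>j<N. 2 * cos_weight N * cos_mean N (?C (Suc j)) * (?e (Suc j) / sqrt a))"
      by (simp only: sum.atMost_shift c0) (simp add: cj)
    ultimately show ?thesis
      by (simp only: sum_distrib_left distrib_left add_divide_distrib sum_divide_distrib) (simp add: mult_ac)
  qed
  ultimately show ?thesis by (simp only:)
qed

section \<open>Poisson summation and the theta inversion\<close>

text \<open>The interval is cut into unit cells centred at the integers. The weight has period 1, so
  each cell can be moved onto the one around 0, where the cells n and -n are taken together.\<close>

lemma integral_times_periodic_weight:
  fixes g :: "real \<Rightarrow> real"
  assumes g: "continuous_on UNIV g"
  shows "integral {- (real m + 1/2)..real m + 1/2} (\<lambda>y. g y * cos (pi * y) ^ (2 * N)) =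
    cos_weight N * (cos_mean N g + (\<Sum>n<m. cos_mean N (\<lambda>y. g (y + real (Suc n)) + g (y - real (Suc n)))))"
proof (induction m)
  case 0
  show ?case using cos_weight_pos[of N] by (simp add: cos_mean_def)
next
  case (Suc m)
  let ?h = "\<lambda>y. g y * cos (pi * y) ^ (2 * N)"
  let ?n = "real (Suc m)"
  have cont: "continuous_on A (\<lambda>y. g (y + c))" for A c
    by (intro continuous_on_compose2[OF g] continuous_intros) auto
  have int: "?h integrable_on {p..q}" for p q
    using cont[of _ 0] by (intro integrable_continuous_interval continuous_intros) auto
  \<comment> \<open>cos (pi k) is 1 or -1, and the even power removes the sign.\<close>
  have periodic: "cos (pi * (y + of_int k)) ^ (2 * N) = cos (pi * y) ^ (2 * N)" for y k
  proof -
    have "(cos (pi * (y + of_int k)))\<^sup>2 = (cos (pi * y))\<^sup>2"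
    proof -
      have "sin (pi * of_int k) = 0" by simp
      moreover from this have "(cos (pi * of_int k))\<^sup>2 = 1" by (simp only: cos_squared_eq) simp
      ultimately show ?thesis by (simp only: distrib_left cos_add power_mult_distrib) simp
    qed
    then show ?thesis by (simp add: power_mult)
  qed
  have shift: "integral {of_int k - 1/2..of_int k + 1/2} ?h =
      integral {- (1/2)..1/2} (\<lambda>y. g (y + of_int k) * cos (pi * y) ^ (2 * N))" for k
  proof -
    have "integral {of_int k - 1/2..of_int k + 1/2} ?h =
        integral {of_int k - 1/2 - of_int k..of_int k + 1/2 - of_int k} (\<lambda>y. ?h (y + of_int k))"
      by (rule integral_shift_real_ivl[symmetric])
    then show ?thesis by (simp only: periodic) simp
  qed
  have "integral {- (real (Suc m) + 1/2)..real (Suc m) + 1/2} ?h =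
      integral {- (real (Suc m) + 1/2)..- (real m + 1/2)} ?h + integral {- (real m + 1/2)..real m + 1/2} ?h +
      integral {real m + 1/2..real (Suc m) + 1/2} ?h"
    using Henstock_Kurzweil_Integration.integral_combine[of "- (real (Suc m) + 1/2)" "- (real m + 1/2)" "real m + 1/2" ?h]
      Henstock_Kurzweil_Integration.integral_combine[of "- (real (Suc m) + 1/2)" "real m + 1/2" "real (Suc m) + 1/2" ?h]
    by (simp add: int)
  also have "integral {- (real (Suc m) + 1/2)..- (real m + 1/2)} ?h =
      integral {- (1/2)..1/2} (\<lambda>y. g (y - ?n) * cos (pi * y) ^ (2 * N))"
  proof -
    have "of_int (- int (Suc m)) - 1/2 = - (real (Suc m) + 1/2)"
      "of_int (- int (Suc m)) + 1/2 = - (real m + 1/2)"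
      "y + of_int (- int (Suc m)) = y - ?n" for y by simp_all
    from shift[of "- int (Suc m)", unfolded this] show ?thesis .
  qed
  also have "integral {real m + 1/2..real (Suc m) + 1/2} ?h =
      integral {- (1/2)..1/2} (\<lambda>y. g (y + ?n) * cos (pi * y) ^ (2 * N))"
    using shift[of "int (Suc m)"] by (simp add: algebra_simps)
  also have "integral {- (1/2)..1/2} (\<lambda>y. g (y - ?n) * cos (pi * y) ^ (2 * N)) +
      integral {- (real m + 1/2)..real m + 1/2} ?h +
      integral {- (1/2)..1/2} (\<lambda>y. g (y + ?n) * cos (pi * y) ^ (2 * N)) =
      integral {- (real m + 1/2)..real m + 1/2} ?h +
      integral {- (1/2)..1/2} (\<lambda>y. (g (y + ?n) + g (y - ?n)) * cos (pi * y) ^ (2 * N))"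
  proof -
    have "continuous_on {- (1/2)..1/2} (\<lambda>y. g (y - ?n))"
      by (intro continuous_on_compose2[OF g] continuous_intros) auto
    with cont[of _ ?n] show ?thesis
      by (simp only: distrib_right Henstock_Kurzweil_Integration.integral_add integrable_times_cos_power)
  qed
  also have "integral {- (1/2)..1/2} (\<lambda>y. (g (y + ?n) + g (y - ?n)) * cos (pi * y) ^ (2 * N)) =
      cos_weight N * cos_mean N (\<lambda>y. g (y + ?n) + g (y - ?n))"
    using cos_weight_pos[of N] by (simp add: cos_mean_def)
  finally show ?case
    by (simp only: Suc.IH sum.lessThan_Suc distrib_left add.assoc)
qed

text \<open>With Jacobi's theta(x), the sum of exp (-pi n^2 x) over all integers n, this is
  (theta(x) - 1) / 2.\<close>

definition theta_tail :: "real \<Rightarrow> real" where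
  "theta_tail x = (\<Sum>n. exp (- (pi * (real (Suc n))\<^sup>2 * x)))"

lemma summable_exp_linear:
  fixes b :: real
  assumes "b > 0"
  shows "summable (\<lambda>n. exp (- (b * real n)))"
proof -
  have "summable (\<lambda>n. exp (- b) ^ n)"
    using assms by (intro summable_geometric) simp
  then show ?thesis by (simp add: mult.commute flip: exp_of_nat_mult)
qed

lemma summable_theta_tail:
  assumes "x > 0"
  shows "summable (\<lambda>n. exp (- (pi * (real (Suc n))\<^sup>2 * x)))"
proof (rule summable_comparison_test')
  show "summable (\<lambda>n. exp (- (pi * x * real n)))"
    using assms by (intro summable_exp_linear) simp
  have "real n \<le> (real (Suc n))\<^sup>2" for n by (simp add: power2_eq_square algebra_simps)
  then show "norm (exp (- (pi * (real (Suc n))\<^sup>2 * x))) \<le> exp (- (pi * x * real n))" for n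
    using assms by (simp add: mult.commute)
qed

text \<open>For fixed N the Gaussian integral against the weight is computed by unit cells and by
  Fourier coefficients. As N grows, the cell means tend to values of the Gaussian at the integers
  and the coefficients tend to 1; equating the limits is Jacobi's transformation of theta.\<close>

lemma theta_tail_inversion:
  fixes a :: real
  assumes a: "a > 0"
  shows "1 + 2 * theta_tail a = (1 + 2 * theta_tail (1 / a)) / sqrt a"
proof -
  define g where "g = (\<lambda>y. exp (- (pi * a * y\<^sup>2)))"
  define G where "G = (\<lambda>n y. g (y + real (Suc n)) + g (y - real (Suc n)))"
  define q where "q = (\<lambda>j N. cos_mean N (\<lambda>y. cos (2 * pi * real (Suc j) * y)))"
  define e where "e = (\<lambda>j. exp (- (pi * (real (Suc j))\<^sup>2 / a)))"
  have g: "continuous_on A g" for A unfolding g_def by (intro continuous_intros)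
  have G: "continuous_on A (G n)" for A n unfolding G_def g_def by (intro continuous_intros)
  have poisson: "(\<lambda>n. cos_mean N (G n)) sums ((1 + 2 * (\<Sum>j. q j N * e j)) / sqrt a - cos_mean N g)" for N
  proof -
    let ?h = "\<lambda>y. g y * cos (pi * y) ^ (2 * N)"
    have gauss: "has_bochner_integral lborel ?h (cos_weight N * ((1 + 2 * (\<Sum>j. q j N * e j)) / sqrt a))"
      unfolding g_def e_def q_def by (rule has_bochner_integral_gaussian_cos_power[OF a])
    have "filterlim (\<lambda>m. real m + 1/2) at_top sequentially" by real_asymp
    from filterlim_compose[OF integral_symmetric_interval_tendsto this, of ?h]
    have "(\<lambda>m. integral {- (real m + 1/2)..real m + 1/2} ?h) \<longlonglongrightarrow>
        cos_weight N * ((1 + 2 * (\<Sum>j. q j N * e j)) / sqrt a)"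
      using gauss by (simp add: has_bochner_integral_iff)
    then have "(\<lambda>m. cos_weight N * (cos_mean N g + (\<Sum>n<m. cos_mean N (G n)))) \<longlonglongrightarrow>
        cos_weight N * ((1 + 2 * (\<Sum>j. q j N * e j)) / sqrt a)"
      unfolding integral_times_periodic_weight[OF g] G_def .
    then have "(\<lambda>m. cos_mean N g + (\<Sum>n<m. cos_mean N (G n))) \<longlonglongrightarrow> (1 + 2 * (\<Sum>j. q j N * e j)) / sqrt a"
      using cos_weight_pos[of N] by (subst (asm) tendsto_mult_left_iff) auto
    from tendsto_diff[OF this tendsto_const[of "cos_mean N g"]] show ?thesis
      by (simp add: sums_def)
  qed
  have "(\<lambda>N. cos_mean N g + (\<Sum>n. cos_mean N (G n))) \<longlonglongrightarrow> g 0 + (\<Sum>n. G n 0)"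
  proof (intro tendsto_add cos_mean_tendsto g)
    \<comment> \<open>For y in the cell around 0, both \<open>y + real (Suc n)\<close> and
      \<open>y - real (Suc n)\<close> stay at least n + 1/2 away from 0, and (n + 1/2)^2 >= n gives
      a geometric majorant uniform in N.\<close>
    have "\<bar>cos_mean N (G n)\<bar> \<le> 2 * exp (- (pi * a * real n))" for n N
    proof -
      have far: "g z \<le> exp (- (pi * a * real n))" if "\<bar>z\<bar> \<ge> real n + 1/2" for z
      proof -
        have "real n \<le> (real n + 1/2)\<^sup>2" by (simp add: power2_eq_square algebra_simps)
        also have "\<dots> \<le> \<bar>z\<bar>\<^sup>2" using that by (intro power_mono) auto
        finally show ?thesis using a by (simp add: g_def)
      qed
      have "\<bar>cos_mean N (G n)\<bar> \<le> cos_mean N (\<lambda>y. 2 * exp (- (pi * a * real n)))"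
      proof (intro cos_mean_abs_le G continuous_intros)
        fix y :: real assume "y \<in> {- (1/2)..1/2}"
        then have "g (y + real (Suc n)) \<le> exp (- (pi * a * real n))"
          "g (y - real (Suc n)) \<le> exp (- (pi * a * real n))" by (auto intro!: far)
        moreover have "G n y \<ge> 0" by (simp add: G_def g_def)
        ultimately show "\<bar>G n y\<bar> \<le> 2 * exp (- (pi * a * real n))" by (simp add: G_def)
      qed
      then show ?thesis by (simp add: cos_mean_const)
    qed
    moreover have "summable (\<lambda>n. 2 * exp (- (pi * a * real n)))"
      using a by (intro summable_mult summable_exp_linear) simp
    ultimately show "(\<lambda>N. \<Sum>n. cos_mean N (G n)) \<longlonglongrightarrow> (\<Sum>n. G n 0)"
      by (intro tannerys_theorem[where M = "\<lambda>n. 2 * exp (- (pi * a * real n))", THEN conjunct2, THEN conjunct2]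
        cos_mean_tendsto G) (auto intro!: always_eventually)
  qed
  moreover have "cos_mean N g + (\<Sum>n. cos_mean N (G n)) = (1 + 2 * (\<Sum>j. q j N * e j)) / sqrt a" for N
    using sums_unique[OF poisson[of N]] by simp
  \<comment> \<open>On the Fourier side the coefficients tend to cos 0 = 1 and stay within [-1, 1],
    so the majorant comes from \<open>e j\<close> alone.\<close>
  moreover have "(\<lambda>N. (1 + 2 * (\<Sum>j. q j N * e j)) / sqrt a) \<longlonglongrightarrow> (1 + 2 * (\<Sum>j. 1 * e j)) / sqrt a"
  proof -
    have q: "(\<lambda>N. q j N) \<longlonglongrightarrow> 1" for j
      using cos_mean_tendsto[of "\<lambda>y. cos (2 * pi * real (Suc j) * y)"]
      by (simp add: q_def continuous_intros)
    have "\<bar>q j N\<bar> \<le> 1" for j N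
    proof -
      have "\<bar>q j N\<bar> \<le> cos_mean N (\<lambda>y. 1)"
        unfolding q_def by (intro cos_mean_abs_le continuous_intros) auto
      then show ?thesis by (simp add: cos_mean_const)
    qed
    moreover have "e j \<le> exp (- (pi / a * real j))" for j
    proof -
      have "real j \<le> (real (Suc j))\<^sup>2" by (simp add: power2_eq_square algebra_simps)
      then show ?thesis using a by (simp add: e_def divide_right_mono)
    qed
    moreover have "e j \<ge> 0" for j by (simp add: e_def)
    ultimately have "\<bar>q j N * e j\<bar> \<le> exp (- (pi / a * real j))" for j N
      unfolding abs_mult by (smt (verit) mult_left_le_one_le abs_ge_zero)
    moreover have "summable (\<lambda>j. exp (- (pi / a * real j)))"
      using a by (intro summable_exp_linear) simp
    ultimately have "(\<lambda>N. \<Sum>j. q j N * e j) \<longlonglongrightarrow> (\<Sum>j. 1 * e j)"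
      by (intro tannerys_theorem[THEN conjunct2, THEN conjunct2] tendsto_mult q tendsto_const)
        (auto intro!: always_eventually)
    then show ?thesis using a by (intro tendsto_intros) auto
  qed
  ultimately have "g 0 + (\<Sum>n. G n 0) = (1 + 2 * (\<Sum>j. 1 * e j)) / sqrt a"
    by (simp add: LIMSEQ_unique)
  moreover have "(\<Sum>n. G n 0) = 2 * theta_tail a"
  proof -
    have "G n 0 = 2 * exp (- (pi * (real (Suc n))\<^sup>2 * a))" for n
      by (simp add: G_def g_def power2_eq_square algebra_simps)
    moreover note summable_theta_tail[OF a]
    ultimately show ?thesis by (simp add: theta_tail_def suminf_mult)
  qed
  ultimately show ?thesis by (simp add: g_def e_def theta_tail_def)
qed

section \<open>Laplace and Mellin transforms\<close>

text \<open>Bridge from the gauge integral to the Lebesgue integral: for a nonnegative measurable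
  function the two agree, and a finite value gives integrability.\<close>

lemma has_bochner_integral_lborel_nonneg:
  fixes f :: "real \<Rightarrow> real"
  assumes "(f has_integral I) S" "\<And>x. x \<in> S \<Longrightarrow> 0 \<le> f x" "I \<ge> 0"
    and [measurable]: "f \<in> borel_measurable borel" "S \<in> sets borel"
  shows "has_bochner_integral lborel (\<lambda>x. indicator S x * f x) I"
proof (rule has_bochner_integral_nn_integral)
  have "((\<lambda>x. indicator S x * f x) has_integral I) UNIV"
  proof -
    have "(\<lambda>x. indicator S x * f x) = (\<lambda>x. if x \<in> S then f x else 0)"
      by (auto simp: fun_eq_iff indicator_def)
    then show ?thesis using assms(1) by (simp only: has_integral_restrict_UNIV)
  qed
  then show "(\<integral>\<^sup>+ x. ennreal (indicator S x * f x) \<partial>lborel) = ennreal I"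
    by (rule nn_integral_has_integral_lborel[rotated 2]) (use assms(2) in \<open>auto simp: indicator_def\<close>)
qed (use assms in \<open>auto simp: indicator_def\<close>)

text \<open>Euler's integral for Gamma under the substitution t = exp u; the factor \<open>c\<close>
  then amounts to a translation of u by \<open>ln c\<close>.\<close>

lemma has_bochner_integral_exp_Gamma:
  fixes c z :: real
  assumes c: "c > 0" and z: "z > 0"
  shows "has_bochner_integral lborel (\<lambda>u. exp (- (c * exp u)) * exp (z * u)) (Gamma z * c powr (- z))"
proof -
  let ?f = "\<lambda>u. exp (- exp u) * exp (z * u)"
  have Gamma: "((\<lambda>t. t powr (z - 1) / exp t) has_integral Gamma z) {0<..}"
  proof -
    have "((\<lambda>t. if t \<in> {0<..} then t powr (z - 1) / exp t else 0) has_integral Gamma z) {0..}"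
      by (rule has_integral_spike[of "{0}", OF _ _ Gamma_integral_real[OF z]]) auto
    then show ?thesis by (subst (asm) has_integral_restrict) auto
  qed
  have range_exp: "range exp = {0::real<..}"
    by (auto simp: image_iff) (metis exp_ln)
  have "(\<lambda>t. t powr (z - 1) / exp t) absolutely_integrable_on exp ` UNIV \<and>
      integral (exp ` UNIV) (\<lambda>t. t powr (z - 1) / exp t) = Gamma z"
    using Gamma by (auto simp: range_exp absolutely_integrable_on_iff_nonneg has_integral_iff)
  then have "(\<lambda>u. \<bar>exp u\<bar> * (exp u powr (z - 1) / exp (exp u))) absolutely_integrable_on UNIV \<and>
      integral UNIV (\<lambda>u. \<bar>exp u\<bar> * (exp u powr (z - 1) / exp (exp u))) = Gamma z"
    by (subst has_absolute_integral_change_of_variables_1')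
      (auto intro!: derivative_eq_intros simp: inj_on_def)
  moreover have "\<bar>exp u\<bar> * (exp u powr (z - 1) / exp (exp u)) = ?f u" for u
    by (simp add: powr_def exp_minus field_simps flip: exp_add)
  ultimately have "(?f has_integral Gamma z) UNIV"
    by (simp add: has_integral_iff absolutely_integrable_on_def)
  from has_bochner_integral_lborel_nonneg[OF this] Gamma_real_pos[OF z]
  have "has_bochner_integral lborel ?f (Gamma z)" by simp
  from lborel_has_bochner_integral_real_affine_iff[THEN iffD1, OF _ this, of 1 "ln c"]
  have "has_bochner_integral lborel (\<lambda>u. ?f (ln c + u)) (Gamma z)" by simp
  from has_bochner_integral_mult_right[OF this, of "c powr (- z)"]
  have "has_bochner_integral lborel (\<lambda>u. c powr (- z) * ?f (ln c + u)) (Gamma z * c powr (- z))"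
    by (simp add: mult.commute)
  moreover have "c powr (- z) * ?f (ln c + u) = exp (- (c * exp u)) * exp (z * u)" for u
    using c by (simp add: powr_def exp_add distrib_left exp_minus)
  ultimately show ?thesis by (simp only:)
qed

lemma has_bochner_integral_exp_atLeast:
  fixes c :: real
  assumes "c > 0"
  shows "has_bochner_integral lborel (\<lambda>u. indicator {0<..} u * exp (- (c * u))) (1 / c)"
proof -
  have "((\<lambda>u. exp (- c * u)) has_integral exp (- c * 0) / c) {0..}"
    using assms by (rule has_integral_exp_minus_to_infinity)
  then have "((\<lambda>u. exp (- (c * u))) has_integral 1 / c) {0..}" by simp
  then have "((\<lambda>u. if u \<in> {0<..} then exp (- (c * u)) else 0) has_integral 1 / c) {0..}"
    by (rule has_integral_spike[of "{0}", rotated 2]) auto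
  then have "((\<lambda>u. exp (- (c * u))) has_integral 1 / c) {0<..}"
    by (subst (asm) has_integral_restrict) auto
  from has_bochner_integral_lborel_nonneg[OF this] assms show ?thesis by simp
qed

text \<open>The second-order remainder of the exponential yields the derivative directly, without any
  interchange of limits.\<close>

lemma holomorphic_bilateral_laplace:
  fixes v :: "real \<Rightarrow> real"
  assumes int: "\<And>B. integrable lborel (\<lambda>u. v u * exp (B * \<bar>u\<bar>))"
  defines "L \<equiv> (\<lambda>z. LINT u|lborel. of_real (v u) * exp (z * of_real u))"
  shows "L holomorphic_on UNIV"
    and "\<And>z::complex. integrable lborel (\<lambda>u. of_real (v u) * exp (z * of_real u))"
proof -
  have [measurable]: "v \<in> borel_measurable borel"
    using int[of 0] by (simp add: borel_measurable_integrable flip: measurable_lborel1)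
  \<comment> \<open>Powers of u are absorbed into \<open>exp \<bar>u\<bar>\<close>, which costs
    nothing because integrability is assumed for every \<open>B\<close>.\<close>
  have le_exp: "\<bar>u\<bar> \<le> exp \<bar>u\<bar>" "u\<^sup>2 \<le> 2 * exp \<bar>u\<bar>" for u :: real
  proof -
    show "\<bar>u\<bar> \<le> exp \<bar>u\<bar>" using exp_ge_add_one_self[of "\<bar>u\<bar>"] by linarith
    show "u\<^sup>2 \<le> 2 * exp \<bar>u\<bar>" using exp_lower_Taylor_quadratic[of "\<bar>u\<bar>"] by simp
  qed
  have norm_exp: "norm (exp (z * of_real u)) \<le> exp (norm z * \<bar>u\<bar>)" for z :: complex and u :: real
    using norm_exp[of "z * of_real u"] by (simp add: norm_mult)
  show int1: "integrable lborel (\<lambda>u. of_real (v u) * exp (z * of_real u))" for z :: complex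
  proof (rule Bochner_Integration.integrable_bound[OF int[of "norm z"]])
    show "AE u in lborel. norm (of_real (v u) * exp (z * of_real u)) \<le> norm (v u * exp (norm z * \<bar>u\<bar>))"
      unfolding norm_mult norm_of_real using norm_exp by (intro AE_I2 mult_mono) auto
  qed simp
  have int2: "integrable lborel (\<lambda>u. of_real (v u) * (of_real u * exp (z * of_real u)))" for z :: complex
  proof (rule Bochner_Integration.integrable_bound[OF int[of "1 + norm z"]])
    have "norm (of_real u * exp (z * of_real u)) \<le> exp \<bar>u\<bar> * exp (norm z * \<bar>u\<bar>)" for u :: real
      unfolding norm_mult using le_exp(1)[of u] norm_exp[of z u] by (intro mult_mono) auto
    then show "AE u in lborel. norm (of_real (v u) * (of_real u * exp (z * of_real u))) \<le> norm (v u * exp ((1 + norm z) * \<bar>u\<bar>))"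
      by (intro AE_I2) (simp add: norm_mult abs_mult distrib_right exp_add mult_left_mono)
  qed simp
  have "(L has_field_derivative (LINT u|lborel. of_real (v u) * (of_real u * exp (z * of_real u)))) (at z)" for z
  proof -
    define D where "D = (LINT u|lborel. of_real (v u) * (of_real u * exp (z * of_real u)))"
    \<comment> \<open>The 2 added to \<open>norm z\<close> pays for exp |h u| with |h| at most 1 and
      for the bound of u^2 by 2 exp |u|.\<close>
    define K where "K = (LINT u|lborel. \<bar>v u\<bar> * (2 * exp ((norm z + 2) * \<bar>u\<bar>)))"
    have intK: "integrable lborel (\<lambda>u. \<bar>v u\<bar> * (2 * exp ((norm z + 2) * \<bar>u\<bar>)))"
      using integrable_mult_right[OF integrable_abs[OF int[of "norm z + 2"]], of 2]
      by (simp add: abs_mult mult_ac)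
    have remainder: "norm (L (z + h) - L z - h * D) \<le> (norm h)\<^sup>2 * K" if h: "norm h \<le> 1" for h
    proof -
      let ?r = "\<lambda>u. of_real (v u) * (exp (z * of_real u) * (exp (h * of_real u) - (1 + h * of_real u)))"
      have eq: "?r u = of_real (v u) * exp ((z + h) * of_real u) - of_real (v u) * exp (z * of_real u) -
          h * (of_real (v u) * (of_real u * exp (z * of_real u)))" for u
        by (simp add: exp_add algebra_simps)
      have "L (z + h) - L z - h * D = (LINT u|lborel. ?r u)"
        unfolding eq L_def D_def using int1 int2 by simp
      also have "norm \<dots> \<le> (LINT u|lborel. (norm h)\<^sup>2 * (\<bar>v u\<bar> * (2 * exp ((norm z + 2) * \<bar>u\<bar>))))"
      proof (rule Bochner_Integration.integral_norm_bound_integral)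
        show "integrable lborel ?r" unfolding eq using int1 int2 by simp
        show "integrable lborel (\<lambda>u. (norm h)\<^sup>2 * (\<bar>v u\<bar> * (2 * exp ((norm z + 2) * \<bar>u\<bar>))))"
          using intK by simp
        fix u :: real
        have "norm (exp (h * of_real u) - (1 + h * of_real u)) \<le>
            exp \<bar>Re (h * of_real u)\<bar> * (norm (h * of_real u))\<^sup>2"
          using Taylor_exp[of "h * of_real u" 1] by (simp add: power2_eq_square)
        also have "\<dots> \<le> exp \<bar>u\<bar> * ((norm h)\<^sup>2 * (2 * exp \<bar>u\<bar>))"
        proof (rule mult_mono)
          have "\<bar>Re h\<bar> * \<bar>u\<bar> \<le> 1 * \<bar>u\<bar>"
            using abs_Re_le_cmod[of h] h by (intro mult_right_mono) auto
          then show "exp \<bar>Re (h * of_real u)\<bar> \<le> exp \<bar>u\<bar>" by (simp add: abs_mult)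
          show "(norm (h * of_real u))\<^sup>2 \<le> (norm h)\<^sup>2 * (2 * exp \<bar>u\<bar>)"
            using le_exp(2)[of u] by (simp add: norm_mult power_mult_distrib mult_left_mono)
        qed auto
        finally have "norm (exp (z * of_real u)) * norm (exp (h * of_real u) - (1 + h * of_real u)) \<le>
            exp (norm z * \<bar>u\<bar>) * (exp \<bar>u\<bar> * ((norm h)\<^sup>2 * (2 * exp \<bar>u\<bar>)))"
          using norm_exp[of z u] by (intro mult_mono) auto
        also have "\<dots> = (norm h)\<^sup>2 * (2 * exp ((norm z + 2) * \<bar>u\<bar>))"
        proof -
          have "exp ((norm z + 2) * \<bar>u\<bar>) = exp (norm z * \<bar>u\<bar>) * (exp \<bar>u\<bar> * exp \<bar>u\<bar>)"
            by (simp add: algebra_simps flip: exp_add)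
          then show ?thesis by (simp add: mult_ac)
        qed
        finally show "norm (?r u) \<le> (norm h)\<^sup>2 * (\<bar>v u\<bar> * (2 * exp ((norm z + 2) * \<bar>u\<bar>)))"
          unfolding norm_mult norm_of_real mult.left_commute[of "(norm h)\<^sup>2" "\<bar>v u\<bar>"]
          by (rule mult_left_mono) simp
      qed
      also have "\<dots> = (norm h)\<^sup>2 * K" by (simp add: K_def)
      finally show ?thesis .
    qed
    have "((\<lambda>h. (L (z + h) - L z) / h - D) \<longlongrightarrow> 0) (at 0)"
    proof (rule Lim_null_comparison)
      have "\<forall>\<^sub>F h in at (0::complex). norm h < 1"
        using eventually_at_in_open[of "ball 0 1" "0::complex"] by (rule eventually_mono) auto
      moreover have "\<forall>\<^sub>F h in at (0::complex). h \<noteq> 0" by (simp add: eventually_at_filter)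
      ultimately show "\<forall>\<^sub>F h in at 0. norm ((L (z + h) - L z) / h - D) \<le> norm h * K"
      proof eventually_elim
        case (elim h)
        have "(L (z + h) - L z) / h - D = (L (z + h) - L z - h * D) / h"
          using elim by (simp add: field_simps)
        also have "norm \<dots> \<le> (norm h)\<^sup>2 * K / norm h"
          unfolding norm_divide using remainder[of h] elim by (intro divide_right_mono) auto
        also have "\<dots> = norm h * K"
          using elim(2) by (simp add: power2_eq_square)
        finally show ?case .
      qed
      show "((\<lambda>h. norm h * K) \<longlongrightarrow> 0) (at (0::complex))"
        by (auto intro!: tendsto_eq_intros)
    qed
    then show ?thesis
      unfolding DERIV_def D_def[symmetric] by (simp add: LIM_zero_iff)
  qed
  then show "L holomorphic_on UNIV"
    by (auto simp: holomorphic_on_def field_differentiable_def intro: DERIV_subset)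
qed

section \<open>Theta in the exponential variable, its Laplace and Mellin transforms\<close>

text \<open>In the variable u = ln x the inversion x -> 1/x becomes the reflection u -> -u, and a
  Mellin transform in x becomes a two-sided Laplace transform in u.\<close>

definition theta_exp :: "real \<Rightarrow> real" where
  "theta_exp u = theta_tail (exp u)"

lemma theta_exp_measurable [measurable]: "theta_exp \<in> borel_measurable borel"
  unfolding theta_exp_def theta_tail_def by measurable

lemma theta_exp_uminus: "theta_exp (- u) = exp (u / 2) * theta_exp u + (exp (u / 2) - 1) / 2"
proof -
  have "sqrt (exp u) = exp (u / 2)"
    by (rule real_sqrt_unique) (simp_all add: power2_eq_square flip: exp_add)
  then have "1 + 2 * theta_exp u = (1 + 2 * theta_exp (- u)) / exp (u / 2)"
    using theta_tail_inversion[of "exp u"] by (simp add: theta_exp_def exp_minus inverse_eq_divide)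
  then have "1 + 2 * theta_exp (- u) = exp (u / 2) * (1 + 2 * theta_exp u)"
    by (simp add: eq_divide_eq mult.commute)
  then show ?thesis by (simp add: field_simps)
qed

lemma theta_tail_nonneg: "x > 0 \<Longrightarrow> theta_tail x \<ge> 0"
  unfolding theta_tail_def by (intro suminf_nonneg summable_theta_tail) auto

text \<open>Since pi (n + 1)^2 x is at least n + x for x >= 1, a factor exp (-x) comes out of every
  term and a geometric series remains.\<close>

lemma theta_tail_le:
  assumes "x \<ge> 1"
  shows "theta_tail x \<le> (\<Sum>n. exp (- (1 * real n))) * exp (- x)"
proof -
  have "exp (- (pi * (real (Suc n))\<^sup>2 * x)) \<le> exp (- (1 * real n)) * exp (- x)" for n
  proof -
    have "real n + x \<le> real (Suc n) * x"
      using assms mult_left_mono[of 1 x "real n"] by (simp add: algebra_simps)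
    also have "\<dots> \<le> (real (Suc n))\<^sup>2 * x"
      using assms by (intro mult_right_mono) (auto simp: power2_eq_square algebra_simps)
    also have "\<dots> \<le> pi * ((real (Suc n))\<^sup>2 * x)"
      using assms pi_gt3 mult_right_mono[of 1 pi "(real (Suc n))\<^sup>2 * x"] by simp
    finally show ?thesis by (simp add: mult.assoc flip: exp_add)
  qed
  then have "theta_tail x \<le> (\<Sum>n. exp (- (1 * real n)) * exp (- x))"
    unfolding theta_tail_def using assms
    by (intro suminf_le summable_theta_tail summable_mult2 summable_exp_linear) auto
  also have "\<dots> = (\<Sum>n. exp (- (1 * real n))) * exp (- x)"
    by (intro suminf_mult2[symmetric] summable_exp_linear) simp
  finally show ?thesis .
qed

text \<open>The cutoff keeps u > 0, that is exp u > 1, where \<open>theta_exp\<close> decays doubly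
  exponentially; the Laplace transform is therefore entire.\<close>

definition theta_half :: "real \<Rightarrow> real" where
  "theta_half u = indicator {0<..} u * theta_exp u"

lemma theta_half_measurable [measurable]: "theta_half \<in> borel_measurable borel"
  unfolding theta_half_def by measurable

lemma theta_half_nonneg: "theta_half u \<ge> 0"
  by (simp add: theta_half_def theta_exp_def theta_tail_nonneg)

text \<open>The decay exp (-exp u) beats every exponential, and the majorant is a Gamma integral.
  The exponent \<open>\<bar>B\<bar> + 1\<close> keeps the argument of Gamma positive.\<close>

lemma integrable_theta_half: "integrable lborel (\<lambda>u. theta_half u * exp (B * \<bar>u\<bar>))"
proof -
  define S where "S = (\<Sum>n. exp (- (1 * real n)))"
  have "integrable lborel (\<lambda>u. exp (- (1 * exp u)) * exp ((\<bar>B\<bar> + 1) * u))"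
    using has_bochner_integral_exp_Gamma[of 1 "\<bar>B\<bar> + 1"] by (simp add: has_bochner_integral_iff)
  then have "integrable lborel (\<lambda>u. S * (exp (- (1 * exp u)) * exp ((\<bar>B\<bar> + 1) * u)))"
    by (rule integrable_mult_right)
  then show ?thesis
  proof (rule Bochner_Integration.integrable_bound)
    have "S \<ge> 0" unfolding S_def by (intro suminf_nonneg summable_exp_linear) auto
    have "theta_half u * exp (B * \<bar>u\<bar>) \<le> S * (exp (- (1 * exp u)) * exp ((\<bar>B\<bar> + 1) * u))" for u
    proof (cases "u > 0")
      case True
      have "theta_exp u \<le> S * exp (- exp u)"
        unfolding S_def theta_exp_def using True by (intro theta_tail_le) simp
      moreover have "exp (B * u) \<le> exp ((\<bar>B\<bar> + 1) * u)"
        using True by (intro exp_le_cancel_iff[THEN iffD2] mult_right_mono) auto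
      ultimately have "theta_exp u * exp (B * u) \<le> (S * exp (- exp u)) * exp ((\<bar>B\<bar> + 1) * u)"
        using \<open>S \<ge> 0\<close> by (intro mult_mono) auto
      then show ?thesis using True by (simp add: theta_half_def mult.assoc)
    next
      case False
      then show ?thesis using \<open>S \<ge> 0\<close> by (simp add: theta_half_def)
    qed
    then show "AE u in lborel. norm (theta_half u * exp (B * \<bar>u\<bar>))
        \<le> norm (S * (exp (- (1 * exp u)) * exp ((\<bar>B\<bar> + 1) * u)))"
      using theta_half_nonneg \<open>S \<ge> 0\<close> by (intro AE_I2) (simp add: abs_mult)
  qed simp
qed

definition theta_laplace :: "complex \<Rightarrow> complex" where
  "theta_laplace z = (LINT u|lborel. of_real (theta_half u) * exp (z * of_real u))"

lemma theta_laplace_holomorphic: "theta_laplace holomorphic_on UNIV"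
  unfolding theta_laplace_def using holomorphic_bilateral_laplace(1)[OF integrable_theta_half] .

lemma theta_laplace_bound:
  assumes "\<bar>Re z\<bar> \<le> B"
  shows "norm (theta_laplace z) \<le> (LINT u|lborel. theta_half u * exp (B * \<bar>u\<bar>))"
  unfolding theta_laplace_def
proof (rule Bochner_Integration.integral_norm_bound_integral)
  fix u :: real
  have "Re z * u \<le> \<bar>Re z\<bar> * \<bar>u\<bar>" by (metis abs_ge_self abs_mult)
  also have "\<dots> \<le> B * \<bar>u\<bar>" using assms by (intro mult_right_mono) auto
  finally have "exp (Re z * u) \<le> exp (B * \<bar>u\<bar>)" by simp
  then show "norm (of_real (theta_half u) * exp (z * of_real u)) \<le> theta_half u * exp (B * \<bar>u\<bar>)"
    using theta_half_nonneg[of u] by (simp add: norm_mult norm_exp_eq_Re mult_left_mono)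
qed (use holomorphic_bilateral_laplace(2)[OF integrable_theta_half] integrable_theta_half in auto)

lemma integrable_theta_half_exp: "integrable lborel (\<lambda>u. theta_half u * exp (z * u))" for z :: real
proof (rule Bochner_Integration.integrable_bound[OF integrable_theta_half[of "\<bar>z\<bar>"]])
  have "z * u \<le> \<bar>z\<bar> * \<bar>u\<bar>" for u by (metis abs_ge_self abs_mult)
  then show "AE u in lborel. norm (theta_half u * exp (z * u)) \<le> norm (theta_half u * exp (\<bar>z\<bar> * \<bar>u\<bar>))"
    using theta_half_nonneg by (intro AE_I2) (simp add: abs_mult mult_left_mono)
qed simp

lemma theta_laplace_of_real:
  "theta_laplace (of_real z) = of_real (LINT u|lborel. theta_half u * exp (z * u))"
  unfolding theta_laplace_def
  by (subst integral_complex_of_real[symmetric]) (simp add: exp_of_real flip: of_real_mult)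

text \<open>Each term of the theta series gives a Gamma integral with factor pi (n + 1)^2. All terms
  are positive, so sum and integral may be exchanged once the series of (n + 1)^(-2 z) converges,
  which is where \<open>z > 1/2\<close> enters.\<close>

lemma has_bochner_integral_theta_mellin:
  fixes z :: real
  assumes z: "z > 1/2"
  shows "has_bochner_integral lborel (\<lambda>u. theta_exp u * exp (z * u))
    (Gamma z * pi powr (- z) * (\<Sum>n. real (Suc n) powr (- (2 * z))))"
proof -
  let ?f = "\<lambda>n u. exp (- (pi * (real (Suc n))\<^sup>2 * exp u)) * exp (z * u)"
  have trm: "has_bochner_integral lborel (?f n) (Gamma z * pi powr (- z) * real (Suc n) powr (- (2 * z)))" for n
  proof -
    have "(pi * (real (Suc n))\<^sup>2) powr (- z) = pi powr (- z) * real (Suc n) powr (- (2 * z))"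
      by (simp add: powr_mult powr_powr flip: powr_numeral)
    with has_bochner_integral_exp_Gamma[of "pi * (real (Suc n))\<^sup>2" z] z show ?thesis
      by (simp add: mult.assoc)
  qed
  have summable: "summable (\<lambda>n. Gamma z * pi powr (- z) * real (Suc n) powr (- (2 * z)))"
    using z summable_real_powr_iff[of "- (2 * z)"]
    by (intro summable_mult) (subst summable_Suc_iff, simp)
  have eq: "theta_exp u * exp (z * u) = (\<Sum>n. ?f n u)" for u
    unfolding theta_exp_def theta_tail_def by (intro suminf_mult2 summable_theta_tail) simp
  have pre: "integrable lborel (?f n)" "AE u in lborel. summable (\<lambda>n. norm (?f n u))"
    "summable (\<lambda>n. LINT u|lborel. norm (?f n u))" for n
    using trm summable summable_mult2[OF summable_theta_tail, of "exp _"]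
    by (auto simp: has_bochner_integral_iff abs_mult simp del: of_nat_Suc)
  have "integrable lborel (\<lambda>u. theta_exp u * exp (z * u))"
    unfolding eq by (rule integrable_suminf[OF pre])
  moreover have "(LINT u|lborel. theta_exp u * exp (z * u)) = (\<Sum>n. LINT u|lborel. ?f n u)"
    unfolding eq by (rule integral_suminf[OF pre])
  moreover have "(\<Sum>n. LINT u|lborel. ?f n u) = Gamma z * pi powr (- z) * (\<Sum>n. real (Suc n) powr (- (2 * z)))"
    using trm z summable_real_powr_iff[of "- (2 * z)"] summable_Suc_iff[of "\<lambda>n. real n powr (- (2 * z))"]
    by (simp add: has_bochner_integral_iff suminf_mult del: of_nat_Suc)
  ultimately show ?thesis by (simp add: has_bochner_integral_iff)
qed

text \<open>Riemann's splitting: the half u < 0 is reflected to u > 0 and rewritten by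
  \<open>theta_exp_uminus\<close>. The elementary part of the inversion integrates to the two
  rational terms; convergence of the first needs \<open>z > 1/2\<close>.\<close>

lemma theta_mellin_split:
  fixes z :: real
  assumes z: "z > 1/2"
  shows "(LINT u|lborel. theta_exp u * exp (z * u)) =
    (LINT u|lborel. theta_half u * exp (z * u)) + (LINT u|lborel. theta_half u * exp ((1/2 - z) * u)) +
    (1 / (z - 1/2) - 1 / z) / 2"
proof -
  let ?i = "indicator {0<..} :: real \<Rightarrow> real"
  let ?k = "\<lambda>u. ?i u * (theta_exp (- u) * exp (- (z * u)))"
  have k: "?k u = theta_half u * exp ((1/2 - z) * u) + (?i u * exp (- ((z - 1/2) * u)) - ?i u * exp (- (z * u))) / 2" for u
  proof -
    have "exp ((1/2 - z) * u) = exp (u / 2) * exp (- (z * u))"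
      "exp (- ((z - 1/2) * u)) = exp (u / 2) * exp (- (z * u))"
      by (simp_all add: algebra_simps flip: exp_add)
    then show ?thesis by (simp add: theta_exp_uminus theta_half_def algebra_simps)
  qed
  have "has_bochner_integral lborel ?k
      ((LINT u|lborel. theta_half u * exp ((1/2 - z) * u)) + (1 / (z - 1/2) - 1 / z) / 2)"
    unfolding k using z integrable_theta_half_exp[of "1/2 - z"]
    by (intro has_bochner_integral_add has_bochner_integral_divide_zero has_bochner_integral_diff
        has_bochner_integral_exp_atLeast) (auto simp: has_bochner_integral_iff)
  from lborel_has_bochner_integral_real_affine_iff[THEN iffD1, OF _ this, of "- 1" 0]
  have k': "has_bochner_integral lborel (\<lambda>u. ?k (- u))
      ((LINT u|lborel. theta_half u * exp ((1/2 - z) * u)) + (1 / (z - 1/2) - 1 / z) / 2)"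
    by simp
  have "(LINT u|lborel. theta_exp u * exp (z * u)) = (LINT u|lborel. theta_half u * exp (z * u) + ?k (- u))"
  \<comment> \<open>The two halves together omit only u = 0, a null set.\<close>
  proof (rule integral_cong_AE)
    show "AE u in lborel. theta_exp u * exp (z * u) = theta_half u * exp (z * u) + ?k (- u)"
      using AE_lborel_singleton[of 0] by eventually_elim (auto simp: theta_half_def indicator_def)
  qed auto
  also have "\<dots> = (LINT u|lborel. theta_half u * exp (z * u)) +
      ((LINT u|lborel. theta_half u * exp ((1/2 - z) * u)) + (1 / (z - 1/2) - 1 / z) / 2)"
    using k' integrable_theta_half_exp[of z] by (simp add: has_bochner_integral_iff)
  finally show ?thesis by simp
qed

section \<open>Riemann zeta and xi\<close>

text \<open>The constant 1/2 is s (s - 1) / 2 times the rational term 1 / (s (s - 1)) that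
  \<open>theta_mellin_split\<close> produces at z = s/2. In this form the symmetry under s -> 1 - s
  is visible.\<close>

definition xi_entire :: "complex \<Rightarrow> complex" where
  "xi_entire s = 1/2 + s * (s - 1) / 2 * (theta_laplace (s / 2) + theta_laplace ((1 - s) / 2))"

lemma xi_entire_holomorphic: "xi_entire holomorphic_on UNIV"
proof -
  have "(theta_laplace \<circ> f) holomorphic_on UNIV" if "f holomorphic_on UNIV" for f
    using holomorphic_on_compose_gen[OF that theta_laplace_holomorphic] by simp
  then have compose: "(\<lambda>s. theta_laplace (f s)) holomorphic_on UNIV" if "f holomorphic_on UNIV" for f
    using that by (simp add: o_def)
  show ?thesis
    unfolding xi_entire_def by (intro holomorphic_intros compose) auto
qed

lemma xi_entire_reflect: "xi_entire (1 - s) = xi_entire s"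
  by (simp add: xi_entire_def algebra_simps)

text \<open>\<open>theta_laplace\<close> is bounded on vertical strips, so only the polynomial
  factor s (s - 1) contributes growth.\<close>

lemma xi_entire_strip_bound:
  "\<exists>C. \<forall>t. \<bar>Im t\<bar> \<le> b \<longrightarrow> norm (xi_entire (1/2 + \<i> * t)) \<le> C * (1 + norm t)\<^sup>2"
proof -
  define M where "M = (LINT u|lborel. theta_half u * exp ((1 + b) * \<bar>u\<bar>))"
  have "M \<ge> 0" unfolding M_def by (intro Bochner_Integration.integral_nonneg) (simp add: theta_half_nonneg)
  have "norm (xi_entire (1/2 + \<i> * t)) \<le> (1/2 + M) * (1 + norm t)\<^sup>2" if t: "\<bar>Im t\<bar> \<le> b" for t
  proof -
    define s where "s = 1/2 + \<i> * t"
    have re: "\<bar>Re (s / 2)\<bar> \<le> 1 + b" "\<bar>Re ((1 - s) / 2)\<bar> \<le> 1 + b"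
      using t by (auto simp: s_def)
    have "norm s \<le> 1 + norm t"
      unfolding s_def using norm_triangle_ineq[of "1/2" "\<i> * t"] by (simp add: norm_mult norm_divide)
    moreover have "norm (s - 1) \<le> 1 + norm t"
    proof -
      have "s - 1 = \<i> * t - 1/2" by (simp add: s_def)
      then show ?thesis using norm_triangle_ineq4[of "\<i> * t" "1/2"] by (simp add: norm_mult norm_divide)
    qed
    ultimately have "norm (s * (s - 1)) \<le> (1 + norm t)\<^sup>2"
      unfolding norm_mult power2_eq_square by (intro mult_mono) auto
    moreover have "norm (theta_laplace (s / 2) + theta_laplace ((1 - s) / 2)) \<le> 2 * M"
      using norm_triangle_mono[OF theta_laplace_bound[OF re(1)] theta_laplace_bound[OF re(2)]]
      by (simp add: M_def)
    ultimately have "norm (s * (s - 1)) * norm (theta_laplace (s / 2) + theta_laplace ((1 - s) / 2))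
        \<le> (1 + norm t)\<^sup>2 * (2 * M)"
      by (intro mult_mono) auto
    then have "norm (s * (s - 1) / 2 * (theta_laplace (s / 2) + theta_laplace ((1 - s) / 2))) \<le> M * (1 + norm t)\<^sup>2"
      by (simp add: norm_mult norm_divide mult.commute)
    moreover have "1 \<le> (1 + norm t)\<^sup>2" by simp
    moreover have "norm (xi_entire s) \<le> 1/2 + norm (s * (s - 1) / 2 * (theta_laplace (s / 2) + theta_laplace ((1 - s) / 2)))"
      unfolding xi_entire_def by (rule norm_triangle_le) (simp add: norm_divide)
    ultimately have "norm (xi_entire s) \<le> 1/2 * (1 + norm t)\<^sup>2 + M * (1 + norm t)\<^sup>2" by linarith
    then show ?thesis by (simp only: s_def distrib_right)
  qed
  then show ?thesis by blast
qed

section \<open>Dirichlet series, continuation of zeta, and xi\<close>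

definition dirichlet_zeta :: "complex \<Rightarrow> complex" where
  "dirichlet_zeta s = (\<Sum>n. 1 / of_nat (Suc n) powr s)"

lemma summable_zeta: "summable (\<lambda>n. real (Suc n) powr (- \<sigma>))" if "\<sigma> > 1"
  using that summable_real_powr_iff[of "- \<sigma>"] by (subst summable_Suc_iff) simp

lemma norm_zeta_term: "norm (1 / of_nat (Suc n) powr s :: complex) = real (Suc n) powr (- Re s)"
proof -
  have "norm (complex_of_real (real (Suc n)) powr s) = real (Suc n) powr Re s"
    using norm_powr_real_powr[of "of_real (real (Suc n))" s] by (simp del: of_nat_Suc)
  then show ?thesis by (simp add: norm_divide powr_minus inverse_eq_divide del: of_nat_Suc)
qed

lemma dirichlet_zeta_bound:
  assumes "Re s > 1"
  shows "norm (dirichlet_zeta s) \<le> (\<Sum>n. real (Suc n) powr (- Re s))"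
  unfolding dirichlet_zeta_def
  using summable_zeta[OF assms] by (intro norm_suminf_le) (simp_all only: norm_zeta_term order_refl)

lemma dirichlet_zeta_holomorphic: "dirichlet_zeta holomorphic_on {s. Re s > 1}"
proof (rule holomorphic_uniform_sequence)
  show "open {s. Re s > 1}" by (rule open_halfspace_Re_gt)
  show "(\<lambda>s. \<Sum>k<n. 1 / of_nat (Suc k) powr s) holomorphic_on {s. Re s > 1}" for n
    by (intro holomorphic_intros) (auto simp del: of_nat_Suc)
  fix s :: complex assume "s \<in> {s. Re s > 1}"
  then have s: "Re s > 1" by simp
  \<comment> \<open>Half the distance to the line Re z = 1, so that on the disc the series is
    dominated by the one with exponent 1 + d.\<close>
  define d where "d = (Re s - 1) / 2"
  have d: "d > 0" using s by (simp add: d_def)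
  have re: "Re z \<ge> 1 + d" if "z \<in> cball s d" for z
  proof -
    have "Re s - Re z \<le> d"
      using that complex_Re_le_cmod[of "s - z"] by (simp add: dist_norm)
    then show ?thesis by (simp add: d_def field_simps)
  qed
  have "uniform_limit (cball s d) (\<lambda>n z. \<Sum>k<n. 1 / of_nat (Suc k) powr z) dirichlet_zeta sequentially"
    unfolding dirichlet_zeta_def
  proof (rule Weierstrass_m_test)
    show "norm (1 / of_nat (Suc n) powr z) \<le> real (Suc n) powr (- (1 + d))" if "z \<in> cball s d" for n z
      unfolding norm_zeta_term using re[OF that] by (intro powr_mono) auto
    show "summable (\<lambda>n. real (Suc n) powr (- (1 + d)))" using d by (intro summable_zeta) simp
  qed
  moreover have "cball s d \<subseteq> {s. Re s > 1}" using re d by force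
  ultimately show "\<exists>d>0. cball s d \<subseteq> {s. Re s > 1} \<and>
      uniform_limit (cball s d) (\<lambda>n z. \<Sum>k<n. 1 / of_nat (Suc k) powr z) dirichlet_zeta sequentially"
    using d by blast
qed

text \<open>The Mellin transform of theta at s/2 is evaluated once termwise and once by splitting.
  Real arguments suffice, since the identity theorem later extends the resulting relation to the
  half-plane.\<close>

lemma xi_entire_of_real:
  fixes s :: real
  assumes s: "s > 1"
  shows "xi_entire (of_real s) =
    of_real (s * (s - 1) / 2 * (Gamma (s / 2) * pi powr (- (s / 2)) * (\<Sum>n. real (Suc n) powr (- s))))"
proof -
  let ?A = "\<lambda>z. LINT u|lborel. theta_half u * exp (z * u)"
  define \<Lambda> where "\<Lambda> = Gamma (s / 2) * pi powr (- (s / 2)) * (\<Sum>n. real (Suc n) powr (- s))"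
  have "\<Lambda> = ?A (s / 2) + ?A (1/2 - s / 2) + (1 / (s / 2 - 1/2) - 1 / (s / 2)) / 2"
    using theta_mellin_split[of "s / 2"] has_bochner_integral_theta_mellin[of "s / 2"] s
    by (simp add: \<Lambda>_def has_bochner_integral_iff)
  moreover have "(1 / (s / 2 - 1/2) - 1 / (s / 2)) / 2 = 1 / (s * (s - 1))"
    using s by (simp add: field_simps)
  ultimately have sum: "?A (s / 2) + ?A ((1 - s) / 2) = \<Lambda> - 1 / (s * (s - 1))"
    by (simp add: diff_divide_distrib)
  have "xi_entire (of_real s) = of_real (1/2 + s * (s - 1) / 2 * (?A (s / 2) + ?A ((1 - s) / 2)))"
    using theta_laplace_of_real[of "s / 2"] theta_laplace_of_real[of "(1 - s) / 2"]
    by (simp add: xi_entire_def)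
  also have "1/2 + s * (s - 1) / 2 * (?A (s / 2) + ?A ((1 - s) / 2)) = s * (s - 1) / 2 * \<Lambda>"
    unfolding sum using s by (simp add: field_simps)
  finally show ?thesis by (simp add: \<Lambda>_def)
qed

text \<open>The defining product of xi solved for zeta. \<open>rGamma\<close>, the entire reciprocal
  of Gamma, avoids the poles of Gamma; the value 0 at 1 follows the convention in
  \<open>riemann_zeta\<close>.\<close>

definition zeta_continuation :: "complex \<Rightarrow> complex" where
  "zeta_continuation s =
    (if s = 1 then 0 else xi_entire s * of_real pi powr (s / 2) * rGamma (1 + s / 2) / (s - 1))"

lemma zeta_continuation_holomorphic: "zeta_continuation holomorphic_on (- {1})"
proof -
  have "(\<lambda>s. xi_entire s * of_real pi powr (s / 2) * rGamma (1 + s / 2) / (s - 1)) holomorphic_on (- {1})"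
    by (intro holomorphic_intros holomorphic_on_subset[OF xi_entire_holomorphic]) auto
  then show ?thesis
    by (rule holomorphic_transform) (simp add: zeta_continuation_def)
qed

lemma zeta_continuation_of_real:
  fixes s :: real
  assumes s: "s > 1"
  shows "zeta_continuation (of_real s) = dirichlet_zeta (of_real s)"
proof -
  define Z where "Z = (\<Sum>n. real (Suc n) powr (- s))"
  have "dirichlet_zeta (of_real s) = of_real Z"
  proof -
    have "1 / of_nat (Suc n) powr (of_real s :: complex) = of_real (real (Suc n) powr (- s))" for n
    proof -
      have "complex_of_real (real (Suc n)) powr of_real s = of_real (real (Suc n) powr s)"
        by (rule powr_of_real) simp
      then show ?thesis by (simp add: powr_minus inverse_eq_divide del: of_nat_Suc)
    qed
    then show ?thesis
      unfolding dirichlet_zeta_def Z_def using summable_zeta[OF s] by (simp only: suminf_of_real)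
  qed
  have "s / 2 \<notin> \<int>\<^sub>\<le>\<^sub>0" using s by (auto elim!: nonpos_Ints_cases)
  then have "Gamma (1 + s / 2) = s / 2 * Gamma (s / 2)"
    using s Gamma_plus1[of "s / 2"] by (simp add: add.commute)
  moreover have G: "Gamma (s / 2) > 0" using s by (intro Gamma_real_pos) simp
  ultimately have rG: "rGamma (1 + s / 2) = 1 / (s / 2 * Gamma (s / 2))"
    by (simp only: rGamma_inverse_Gamma inverse_eq_divide)
  have "rGamma (1 + of_real s / 2) = complex_of_real (rGamma (1 + s / 2))"
    by (simp flip: rGamma_complex_of_real)
  moreover have "complex_of_real pi powr (of_real s / 2) = of_real (pi powr (s / 2))"
    using powr_of_real[of pi "s / 2"] by simp
  moreover have "of_real s - 1 = complex_of_real (s - 1)" "complex_of_real s \<noteq> 1" using s by auto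
  ultimately have "zeta_continuation (of_real s) =
      of_real (s * (s - 1) / 2 * (Gamma (s / 2) * pi powr (- (s / 2)) * Z) * pi powr (s / 2) * rGamma (1 + s / 2) / (s - 1))"
    unfolding zeta_continuation_def xi_entire_of_real[OF s] Z_def by (simp only: if_False of_real_mult of_real_divide)
  also have "s * (s - 1) / 2 * (Gamma (s / 2) * pi powr (- (s / 2)) * Z) * pi powr (s / 2) * rGamma (1 + s / 2) / (s - 1) = Z"
  proof -
    have "x * y / 2 * (g * inverse p * Z) * p * (1 / (x / 2 * g)) / y = Z"
      if "x > 0" "y > 0" "g > 0" "p > 0" for x y g p :: real
      using that by (simp add: field_simps)
    then show ?thesis
      unfolding rG powr_minus by this (use s G in auto)
  qed
  finally show ?thesis using \<open>dirichlet_zeta (of_real s) = of_real Z\<close> by simp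
qed

text \<open>Identity theorem: both sides are holomorphic on the half-plane and agree on the real ray
  s > 1, which accumulates at 2.\<close>

lemma zeta_continuation_eq_dirichlet:
  assumes "Re s > 1"
  shows "zeta_continuation s = dirichlet_zeta s"
proof -
  let ?H = "{s. Re s > 1}"
  have "zeta_continuation s - dirichlet_zeta s = 0"
  proof (rule analytic_continuation[of "\<lambda>s. zeta_continuation s - dirichlet_zeta s" ?H "of_real ` {1<..}" 2])
    show "(\<lambda>s. zeta_continuation s - dirichlet_zeta s) holomorphic_on ?H"
      by (intro holomorphic_intros dirichlet_zeta_holomorphic holomorphic_on_subset[OF zeta_continuation_holomorphic]) auto
    show "open ?H" by (rule open_halfspace_Re_gt)
    show "connected ?H" by (intro convex_connected convex_halfspace_Re_gt)
    show "2 islimpt (of_real ` {1<..} :: complex set)"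
    proof (rule islimptI)
      fix T :: "complex set" assume T: "2 \<in> T" "open T"
      then obtain e where e: "e > 0" "ball 2 e \<subseteq> T" by (meson open_contains_ball)
      show "\<exists>y\<in>of_real ` {1<..}. y \<in> T \<and> y \<noteq> 2"
      proof (intro bexI[of _ "of_real (2 + e / 2)"] conjI)
        have "dist 2 (complex_of_real (2 + e / 2)) < e" using e by (simp add: dist_norm)
        then show "complex_of_real (2 + e / 2) \<in> T" using e by auto
        show "complex_of_real (2 + e / 2) \<noteq> 2" using e by (simp add: complex_eq_iff)
        show "complex_of_real (2 + e / 2) \<in> of_real ` {1<..}" using e by (intro imageI) simp
      qed
    qed
  qed (use assms zeta_continuation_of_real in auto)
  then show ?thesis by simp
qed

lemma riemann_zeta_eq: "riemann_zeta = zeta_continuation"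
proof (rule riemann_zeta_eqI)
  show "zeta_continuation holomorphic_on (- {1})" by (rule zeta_continuation_holomorphic)
  show "zeta_continuation s = (\<Sum>n. 1 / of_nat (Suc n) powr s)" if "Re s > 1" for s
    using zeta_continuation_eq_dirichlet[OF that] by (simp only: dirichlet_zeta_def)
  show "zeta_continuation 1 = 0" by (simp add: zeta_continuation_def)
qed

lemma xi_product_eq:
  assumes "s \<noteq> 1" "rGamma (1 + s / 2) \<noteq> 0"
  shows "(s - 1) * of_real pi powr (- s / 2) * Gamma (1 + s / 2) * riemann_zeta s = xi_entire s"
proof -
  have "of_real pi powr (- s / 2) * of_real pi powr (s / 2) = (1 :: complex)"
    by (simp flip: powr_add)
  moreover have "Gamma (1 + s / 2) * rGamma (1 + s / 2) = 1"
    using assms(2) by (simp add: Gamma_def)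
  moreover have "(s - 1) * of_real pi powr (- s / 2) * Gamma (1 + s / 2) * riemann_zeta s =
      (of_real pi powr (- s / 2) * of_real pi powr (s / 2)) * (Gamma (1 + s / 2) * rGamma (1 + s / 2)) * xi_entire s"
    using assms(1) by (simp add: riemann_zeta_eq zeta_continuation_def)
  ultimately show ?thesis by simp
qed

text \<open>The product equals \<open>xi_entire\<close> away from 1 and the isolated zeros of
  \<open>rGamma (1 + s / 2)\<close>. Its limit at every point is therefore the value of the
  continuous \<open>xi_entire\<close>, and this limit is what \<open>remove_sings\<close>
  assigns.\<close>

lemma riemann_xi_eq: "riemann_xi = xi_entire"
proof
  fix z :: complex
  let ?p = "\<lambda>s. (s - 1) * of_real pi powr (- s / 2) * Gamma (1 + s / 2) * riemann_zeta s"
  have "\<forall>\<^sub>F s in at z. s \<noteq> 1 \<and> rGamma (1 + s / 2) \<noteq> 0"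
  proof (rule eventually_conj)
    show "\<forall>\<^sub>F s in at z. s \<noteq> 1" by (rule eventually_neq_at_within)
    have "(\<lambda>s. rGamma (1 + s / 2)) holomorphic_on UNIV"
      by (intro holomorphic_intros) auto
    moreover have "rGamma (1 + 0 / 2) \<noteq> (0::complex)" by simp
    ultimately show "\<forall>\<^sub>F s in at z. rGamma (1 + s / 2) \<noteq> 0"
      using non_zero_neighbour_alt[of "\<lambda>s. rGamma (1 + s / 2)" UNIV z 0] by auto
  qed
  then have "\<forall>\<^sub>F s in at z. xi_entire s = ?p s"
    by eventually_elim (use xi_product_eq in auto)
  moreover have "(xi_entire \<longlongrightarrow> xi_entire z) (at z)"
    using holomorphic_on_imp_continuous_on[OF xi_entire_holomorphic]
    by (simp add: continuous_on_eq_continuous_at isContD)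
  ultimately have "?p \<midarrow>z\<rightarrow> xi_entire z"
    by (rule Lim_transform_eventually[rotated])
  then show "riemann_xi z = xi_entire z"
    unfolding riemann_xi_def by (rule remove_sings_eqI)
qed

section \<open>Decay of Gamma and xi on vertical lines\<close>

text \<open>Absolute values are taken inside Euler's integral, where the modulus of t^(z - 1)
  depends only on \<open>Re z\<close>.\<close>

lemma norm_Gamma_complex_le:
  assumes "Re z > 0"
  shows "norm (Gamma z) \<le> Gamma (Re z)"
proof -
  have "Gamma z = integral {0..} (\<lambda>t. of_real t powr (z - 1) / of_real (exp t))"
    using Gamma_integral_complex[OF assms] by (simp add: integral_unique)
  also have "norm \<dots> \<le> integral {0..} (\<lambda>t. t powr (Re z - 1) / exp t)"
    using Gamma_integral_complex[OF assms] Gamma_integral_real[OF assms]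
    by (intro integral_norm_bound_integral) (auto simp: norm_divide norm_powr_real_powr has_integral_iff)
  also have "\<dots> = Gamma (Re z)"
    using Gamma_integral_real[OF assms] by (simp add: integral_unique)
  finally show ?thesis .
qed

text \<open>In Gamma (z + 3) = (z + 2) (z + 1) z Gamma (z) each of the three linear factors has
  modulus at least |z|, and the left side is bounded by Gamma at the real part.\<close>

lemma Gamma_vertical_decay:
  assumes z: "Re z \<ge> 1"
  shows "norm (Gamma z) * (norm z) ^ 3 \<le> Gamma (Re z + 3)"
proof -
  have notin: "z \<notin> \<int>\<^sub>\<le>\<^sub>0" "z + 1 \<notin> \<int>\<^sub>\<le>\<^sub>0" "z + 1 + 1 \<notin> \<int>\<^sub>\<le>\<^sub>0"
  proof -
    have "w \<notin> \<int>\<^sub>\<le>\<^sub>0" if "Re w > 0" for w :: complex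
      using that by (auto elim!: nonpos_Ints_cases)
    then show "z \<notin> \<int>\<^sub>\<le>\<^sub>0" "z + 1 \<notin> \<int>\<^sub>\<le>\<^sub>0" "z + 1 + 1 \<notin> \<int>\<^sub>\<le>\<^sub>0"
      using z by simp_all
  qed
  have "Gamma (z + 3) = (z + 1 + 1) * ((z + 1) * (z * Gamma z))"
    using notin[THEN Gamma_plus1] by (simp add: add.assoc)
  then have "norm (z + 1 + 1) * (norm (z + 1) * (norm z * norm (Gamma z))) = norm (Gamma (z + 3))"
    by (simp add: norm_mult)
  also have "\<dots> \<le> Gamma (Re z + 3)" using norm_Gamma_complex_le[of "z + 3"] z by simp
  finally have le: "norm (z + 1 + 1) * (norm (z + 1) * (norm z * norm (Gamma z))) \<le> Gamma (Re z + 3)" .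
  have "norm z \<le> norm (z + 1)" "norm z \<le> norm (z + 1 + 1)"
    using z by (auto simp: cmod_def intro!: power_mono)
  then have "norm z * (norm z * (norm z * norm (Gamma z))) \<le> norm (z + 1 + 1) * (norm (z + 1) * (norm z * norm (Gamma z)))"
    by (intro mult_mono) auto
  with le show ?thesis by (simp add: power3_eq_cube mult_ac)
qed

text \<open>Of the three powers of |z| gained from Gamma the factor s - 1 uses one; the other two
  leave an integrable bound. The Dirichlet series is bounded on the line because its real part
  exceeds 1.\<close>

lemma xi_entire_vertical_decay:
  assumes \<sigma>: "\<sigma> > 1"
  shows "\<exists>K. \<forall>y. norm (xi_entire (Complex \<sigma> y)) \<le> K * inverse (1 + y\<^sup>2)"
proof -
  define Z g where "Z = (\<Sum>n. real (Suc n) powr (- \<sigma>))" and "g = Gamma (1 + \<sigma> / 2 + 3)"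
  \<comment> \<open>20 is 5 times 4: the 5 comes from \<open>norm (s - 1) \<le> 5 * norm z\<close>,
    the 4 from \<open>(1 + y\<^sup>2) / 4 \<le> (norm z)\<^sup>2\<close>.\<close>
  have "norm (xi_entire (Complex \<sigma> y)) \<le> 20 * g * pi powr (- \<sigma> / 2) * Z * inverse (1 + y\<^sup>2)" for y
  proof -
    define s z where "s = Complex \<sigma> y" and "z = 1 + s / 2"
    have z: "Re z = 1 + \<sigma> / 2" "Im z = y / 2" by (simp_all add: z_def s_def)
    have "s \<noteq> 1" using \<sigma> by (auto simp: s_def complex_eq_iff)
    moreover have "rGamma z \<noteq> 0"
      using z \<sigma> by (auto simp: rGamma_eq_zero_iff elim!: nonpos_Ints_cases)
    ultimately have "xi_entire s = (s - 1) * of_real pi powr (- s / 2) * Gamma z * dirichlet_zeta s"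
      using xi_product_eq[of s] zeta_continuation_eq_dirichlet[of s] \<sigma>
      by (simp add: z_def riemann_zeta_eq s_def)
    then have "norm (xi_entire s) = (norm (s - 1) * norm (Gamma z)) * pi powr (- \<sigma> / 2) * norm (dirichlet_zeta s)"
      by (simp add: norm_mult norm_powr_real_powr s_def mult_ac)
    also have "\<dots> \<le> (20 * g * inverse (1 + y\<^sup>2)) * pi powr (- \<sigma> / 2) * Z"
    proof (rule mult_mono[OF mult_right_mono])
      show "norm (dirichlet_zeta s) \<le> Z"
        using dirichlet_zeta_bound[of s] \<sigma> by (simp add: s_def Z_def)
      have "(norm z)\<^sup>2 = (1 + \<sigma> / 2)\<^sup>2 + y\<^sup>2 / 4" by (simp add: cmod_power2 z power_divide)
      moreover have "1 \<le> (1 + \<sigma> / 2)\<^sup>2" using \<sigma> by (intro one_le_power) simp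
      ultimately have "(1 + y\<^sup>2) / 4 \<le> (norm z)\<^sup>2" by simp
      have "1 \<le> norm z" using complex_Re_le_cmod[of z] z \<sigma> by simp
      have "norm (s - 1) \<le> 5 * norm z"
      proof -
        have "s - 1 = 2 * z - 3" by (simp add: z_def)
        moreover have "norm (2 * z - 3) \<le> 5 * norm z"
          using norm_triangle_ineq4[of "2 * z" 3] \<open>1 \<le> norm z\<close> by (simp add: norm_mult)
        ultimately show ?thesis by (simp only:)
      qed
      then have "norm (s - 1) * norm (Gamma z) * ((1 + y\<^sup>2) / 4) \<le> (5 * norm z) * norm (Gamma z) * (norm z)\<^sup>2"
        using \<open>(1 + y\<^sup>2) / 4 \<le> (norm z)\<^sup>2\<close> by (intro mult_mono) auto
      also have "\<dots> = 5 * (norm (Gamma z) * norm z ^ 3)" by (simp add: power3_eq_cube power2_eq_square)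
      also have "\<dots> \<le> 5 * g" using Gamma_vertical_decay[of z] z \<sigma> by (simp add: g_def)
      finally have "norm (s - 1) * norm (Gamma z) * (1 + y\<^sup>2) \<le> 20 * g" by simp
      moreover have "1 + y\<^sup>2 > 0" by (simp add: add_pos_nonneg)
      ultimately show "norm (s - 1) * norm (Gamma z) \<le> 20 * g * inverse (1 + y\<^sup>2)"
        by (simp add: inverse_eq_divide pos_le_divide_eq)
      have "g > 0" unfolding g_def using \<sigma> by (intro Gamma_real_pos) simp
      then show "0 \<le> 20 * g * inverse (1 + y\<^sup>2) * pi powr (- \<sigma> / 2)" by simp
    qed auto
    finally show ?thesis by (simp add: s_def mult_ac)
  qed
  then show ?thesis by blast
qed

section \<open>The contour shift applied to Xi\<close>

theorem theorem2:
  fixes c :: real and \<tau> :: complex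
  assumes "- 3 / 2 < c" and "c < - 1 / 2"
    and "\<bar>Im \<tau>\<bar> < 1 / 2"
  shows "hline_integrable c (\<lambda>t. t * riemann_Xi t / (t\<^sup>2 - \<tau>\<^sup>2)) \<and>
    riemann_Xi \<tau> =
      1 / (of_real pi * \<i>) * hline_integral c (\<lambda>t. t * riemann_Xi t / (t\<^sup>2 - \<tau>\<^sup>2))"
proof -
  \<comment> \<open>A lower bound for the distance of \<open>\<tau>\<close> and
    \<open>- \<tau>\<close> from the line Im t = c; it is positive because -c > 1/2 > |Im
    \<tau>|.\<close>
  define d where "d = - c - \<bar>Im \<tau>\<bar>"
  have d: "d > 0" using assms by (simp add: d_def)
  let ?f = "\<lambda>x. Complex x c * riemann_Xi (Complex x c) / ((Complex x c)\<^sup>2 - \<tau>\<^sup>2)"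
  have Xi: "riemann_Xi t = xi_entire (1 / 2 + \<i> * t)" for t
    by (simp add: riemann_Xi_def riemann_xi_eq)
  have holo: "riemann_Xi holomorphic_on UNIV"
  proof -
    have "(xi_entire \<circ> (\<lambda>t. 1 / 2 + \<i> * t)) holomorphic_on UNIV"
      by (intro holomorphic_on_compose holomorphic_intros holomorphic_on_subset[OF xi_entire_holomorphic]) auto
    then show ?thesis by (simp add: o_def Xi[abs_def])
  qed
  have even: "riemann_Xi (- t) = riemann_Xi t" for t
    using xi_entire_reflect[of "1 / 2 + \<i> * t"] by (simp add: Xi algebra_simps)
  have kernel: "norm (Complex x c / ((Complex x c)\<^sup>2 - \<tau>\<^sup>2)) \<le> 1 / d" "(Complex x c)\<^sup>2 - \<tau>\<^sup>2 \<noteq> 0" for x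
  proof -
    have "d \<le> norm (Complex x c - z)" if "\<bar>Im z\<bar> = \<bar>Im \<tau>\<bar>" for z
      using abs_Im_le_cmod[of "Complex x c - z"] that assms by (simp add: d_def)
    from this[of \<tau>] this[of "- \<tau>"]
    show "norm (Complex x c / ((Complex x c)\<^sup>2 - \<tau>\<^sup>2)) \<le> 1 / d" "(Complex x c)\<^sup>2 - \<tau>\<^sup>2 \<noteq> 0"
      using norm_symmetric_kernel_le[OF d, of "Complex x c" \<tau>] by simp_all
  qed
  \<comment> \<open>For t = x + i c the point 1/2 + i t is (1/2 - c) + i x, and 1/2 - c > 1 because
    c < -1/2. The line of integration thus lies in the half-plane of the Dirichlet series.\<close>
  obtain K where K: "\<And>y. norm (xi_entire (Complex (1/2 - c) y)) \<le> K * inverse (1 + y\<^sup>2)"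
    using xi_entire_vertical_decay[of "1/2 - c"] assms by auto
  have int: "integrable lborel ?f"
  proof (rule Bochner_Integration.integrable_bound)
    have "integrable lborel (\<lambda>x::real. inverse (1 + x\<^sup>2))"
      using integrable_inverse_1_plus_square by (simp add: set_integrable_def einterval_eq)
    then show "integrable lborel (\<lambda>x. 1 / d * (K * inverse (1 + x\<^sup>2)))" by simp
    have "continuous_on UNIV (\<lambda>x. riemann_Xi (Complex x c))"
      unfolding Complex_eq
      by (intro continuous_on_compose2[OF holomorphic_on_imp_continuous_on[OF holo]] continuous_intros) auto
    then have "continuous_on UNIV ?f"
      using kernel(2) unfolding Complex_eq by (intro continuous_intros) auto
    then show "?f \<in> borel_measurable lborel"
      by (simp add: borel_measurable_continuous_onI)
    have "norm (?f x) \<le> 1 / d * (K * inverse (1 + x\<^sup>2))" for x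
    proof -
      have "1 / 2 + \<i> * Complex x c = Complex (1/2 - c) x" by (simp add: complex_eq_iff)
      then have "norm (riemann_Xi (Complex x c)) \<le> K * inverse (1 + x\<^sup>2)"
        using K[of x] by (simp add: Xi)
      moreover have "?f x = Complex x c / ((Complex x c)\<^sup>2 - \<tau>\<^sup>2) * riemann_Xi (Complex x c)" by simp
      ultimately show ?thesis
        using kernel(1)[of x] d by (simp only: norm_mult) (intro mult_mono, auto)
    qed
    then show "AE x in lborel. norm (?f x) \<le> norm (1 / d * (K * inverse (1 + x\<^sup>2)))"
      by (intro AE_I2) (metis abs_ge_self order_trans real_norm_def)
  qed
  obtain C where C: "\<And>t. \<bar>Im t\<bar> \<le> - c \<Longrightarrow> norm (riemann_Xi t) \<le> C * (1 + norm t)\<^sup>2"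
    using xi_entire_strip_bound[of "- c"] unfolding Xi by blast
  \<comment> \<open>The half-width of the strip is b = -c, so the lower edge Im t = -b is the line
    of integration.\<close>
  have "(LINT x|lborel. Complex x (- (- c)) * riemann_Xi (Complex x (- (- c))) / ((Complex x (- (- c)))\<^sup>2 - \<tau>\<^sup>2)) =
      of_real pi * \<i> * riemann_Xi \<tau>"
    by (rule even_cauchy_kernel_line[OF holo even _ C]) (use int assms in auto)
  then show ?thesis
    using int by (simp add: hline_integrable_def hline_integral_def)
qed

end
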